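(* (Linearization of the state equation.) Let $(t,w)\in\mathbb G$, $\alpha\in\mathcal A_{t,T}$ and $x(\cdot)=x(\cdot\,|\,t,w,\alpha)$. Set $D(s):=s-\tau(s,x(s))$, $s\in[t,T]$, and denote its inverse by $\gamma:[D(t),D(T)]\to[t,T]$. Let $R>0$ be fixed. Suppose that $\{w_\varepsilon\}_{\varepsilon>0}\subset V(R)$ satisfies $$\operatorname{supp}w_\varepsilon\subset[-\varepsilon,0],\qquad\|w_\varepsilon\|_\infty=O(\varepsilon),$$ and that there exists $\bar v\in\mathbb R^n$ such that $w_\varepsilon(0)=\varepsilon\bar v+o(\varepsilon)$ as $\varepsilon\downarrow0$. Assume also that $w\in V(R)$. Let $x_\varepsilon(s):=x(s\,|\,t,w+w_\varepsilon,\alpha)$. Then $$x_\varepsilon(s)=x(s)+\varepsilon v(s)+o(\varepsilon)$$ uniformly for $s\in[t,T]$, where $v$ is the unique solution of the linearized equation $$\begin{aligned}\dot v(s)=&\ f_z(s,x(s),x(D(s)),\alpha(s))\,v(s)\\&-f_y(s,x(s),x(D(s)),\alpha(s))\,\dot x(D(s))\,\bigl(\tau_z(s,x(s))\cdot v(s)\bigr)\\&+f_y(s,x(s),x(D(s)),\alpha(s))\,v(D(s))\,\mathbf 1_{[t,D(T)]}(D(s))\end{aligned}$$ for a.e. $s\in(t,T)$, with initial condition $v(t)=\bar v$.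
   Context: Setting. Let $t_0<T$, $I=[t_0,T]$, $n,m\ge 1$; $A\subset\mathbb R^m$ is nonempty, convex and compact. $\|\cdot\|$ is the Euclidean norm on $\mathbb R^n$; $\|\cdot\|_1,\|\cdot\|_\infty$ are the usual $L^1,L^\infty$ norms for functions on $[-\bar\tau,0]$ (with $\bar\tau$ introduced in (7) below). $\mathbb G:=I\times\operatorname{Lip}([-\bar\tau,0];\mathbb R^n)$. For $t_0\le t<s\le T$, $\mathcal A_{t,s}$ is the set of measurable functions $\alpha:(t,s)\to A$. For $R>0$: $P(R)=\{w\in\operatorname{Lip}([-\bar\tau,0];\mathbb R^n):\|w\|_\infty\le R\}$, $V(R)=\{w\in P(R):\|\dot w\|_\infty\le R\}$, $B_R=\{x\in\mathbb R^n:\|x\|\le R\}$. $\mathcal X=\{(z,w):w\in\operatorname{Lip}([-\bar\tau,0];\mathbb R^n),\ z=w(0)\}$ with norm $\|(z,w)\|_{\mathcal X}=\|z\|+\|w\|_1$. Standing assumptions. (1) $f:I\times\mathbb R^n\times\mathbb R^n\times A\to\mathbb R^n$ and $L:I\times\mathbb R^n\times\mathbb R^n\times A\to\mathbb R$ (arguments $(t,z,y,a)$) are continuous. (2) There is $\lambda_f>0$ with $\|f(t,z,y,a)-f(t,z',y',a)\|\le\lambda_f(\|z-z'\|+\|y-y'\|)$ for all arguments, and hence $\|f(t,z,y,a)\|\le C_f(1+\|z\|+\|y\|)$ for some $C_f>0$. (3) For every $(t,z,y)$ the set $\{(f(t,z,y,a),\ell)\in\mathbb R^n\times\mathbb R:a\in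 A,\ \ell\ge L(t,z,y,a)\}$ is convex. (4) For every $R>0$ there is $\lambda_L(R)>0$ with $|L(t,z,y,a)-L(t,z',y',a)|\le\lambda_L(R)(\|z-z'\|+\|y-y'\|)$ for $t\in I$, $a\in A$, $z,y,z',y'\in B_R$. (5) There is $C_L>0$ with $|L(t,z,y,a)|\le C_L(1+\|z\|+\|y\|)$ for all arguments. (6) $g:\mathcal X\to\mathbb R$ and for every $R>0$ there is $\lambda_g(R)>0$ with $|g(z_1,w_1)-g(z_2,w_2)|\le\lambda_g(R)\|(z_1,w_1)-(z_2,w_2)\|_{\mathcal X}$ for all $(z_i,w_i)\in\mathcal X$ with $w_i\in P(R)$. (7) $\tau:I\times\mathbb R^n\to[0,\infty)$ is $C^1$ with supremum $\bar\tau<\infty$, and there is $\lambda_\tau>0$ with $|\tau(t,z)-\tau(t,y)|\le\lambda_\tau\|z-y\|$ for all $t\in I$, $z,y\in\mathbb R^n$. State equation. For $(t,w)\in\mathbb G$ and $\alpha\in\mathcal A_{t,T}$, $x(\cdot\,|\,t,w,\alpha)$ denotes the unique Lipschitz $x:[t-\bar\tau,T]\to\mathbb R^n$ with $\dot x(s)=f(s,x(s),x(s-\tau(s,x(s))),\alpha(s))$ for a.e. $s\in(t,T)$ and $x(t+\theta)=w(\theta)$ for $\theta\in[-\bar\tau,0]$ (it exists and is unique under (1)-(7)). (8) (Monotone delay) For every $r>0$ there is $d(r)>0$ such that for every such solution with $t\in I$, $w\in P(r)$, $\alpha\in\mathcal A_{t,T}$: $1-\tau_t(s,x(s))-\tau_z(s,x(s))\cdot\dot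 x(s)\ge d(r)$ for a.e. $s\in[t,T]$. (So $s\mapsto s-\tau(s,x(s))$ is strictly increasing and invertible onto its image.) (9) In addition, $f$ and $L$ are $C^1$ in $(z,y)$ uniformly with respect to $(t,a)$. $f_z,f_y$ are the Jacobian matrices of $f$ in $z$ and $y$; $\tau_z$ is the gradient of $\tau$ in $z$; vectors are column vectors. The term with the indicator is $0$ when $D(s)<t$ (and $[t,D(T)]=\emptyset$ if $D(T)<t$). Solutions of the linearized equation are Lipschitz functions $v:[t,T]\to\mathbb R^n$ satisfying it a.e. *)

theory Defs
  imports "HOL-Analysis.Analysis" "HOL-Library.Landau_Symbols" "HOL-Probability.Essential_Supremum"
begin

text \<open>
  Functions on an interval \<open>[-h, 0]\<close> are represented by total functions of type
  \<open>real \<Rightarrow> real ^ 'n\<close>; only their values on that interval matter.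
  The number \<open>h\<close> is instantiated with the supremum of the delay \<open>\<tau>\<close>.
\<close>

definition Lip :: "real \<Rightarrow> (real \<Rightarrow> real ^ 'n) set" where
  "Lip h = {w. \<exists>C. C-lipschitz_on {-h..0} w}"

definition L1_norm :: "real \<Rightarrow> (real \<Rightarrow> real ^ 'n) \<Rightarrow> real" where
  "L1_norm h w = (LINT \<theta>|lebesgue_on {-h..0}. norm (w \<theta>))"

definition Linf_norm :: "real \<Rightarrow> (real \<Rightarrow> real ^ 'n) \<Rightarrow> ennreal" where
  "Linf_norm h w = esssup (lebesgue_on {-h..0}) (\<lambda>\<theta>. ennreal (norm (w \<theta>)))"

definition P_set :: "real \<Rightarrow> real \<Rightarrow> (real \<Rightarrow> real ^ 'n) set" where
  "P_set h R = {w \<in> Lip h. Linf_norm h w \<le> ennreal R}"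

definition V_set :: "real \<Rightarrow> real \<Rightarrow> (real \<Rightarrow> real ^ 'n) set" where
  "V_set h R = {w \<in> P_set h R. Linf_norm h (\<lambda>\<theta>. vector_derivative w (at \<theta>)) \<le> ennreal R}"

definition X_space :: "real \<Rightarrow> ((real ^ 'n) \<times> (real \<Rightarrow> real ^ 'n)) set" where
  "X_space h = {(z, w). w \<in> Lip h \<and> z = w 0}"

definition X_norm :: "real \<Rightarrow> (real ^ 'n) \<times> (real \<Rightarrow> real ^ 'n) \<Rightarrow> real" where
  "X_norm h = (\<lambda>(z, w). norm z + L1_norm h w)"

definition controls :: "(real ^ 'm) set \<Rightarrow> real \<Rightarrow> real \<Rightarrow> (real \<Rightarrow> real ^ 'm) set" where
  "controls A t s = {\<alpha>. \<alpha> \<in> borel_measurable (lebesgue_on {t<..<s}) \<and> \<alpha> ` {t<..<s} \<subseteq> A}"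

text \<open>
  \<open>is_trajectory h T f \<tau> t w \<alpha> x\<close>: the function \<open>x\<close>, restricted to \<open>[t - h, T]\<close>, is the
  solution \<open>x(\<cdot> | t, w, \<alpha>)\<close> of the state equation.
\<close>

definition is_trajectory ::
  "real \<Rightarrow> real \<Rightarrow> (real \<Rightarrow> real ^ 'n \<Rightarrow> real ^ 'n \<Rightarrow> real ^ 'm \<Rightarrow> real ^ 'n) \<Rightarrow>
   (real \<Rightarrow> real ^ 'n \<Rightarrow> real) \<Rightarrow> real \<Rightarrow> (real \<Rightarrow> real ^ 'n) \<Rightarrow> (real \<Rightarrow> real ^ 'm) \<Rightarrow>
   (real \<Rightarrow> real ^ 'n) \<Rightarrow> bool" where
  "is_trajectory h T f \<tau> t w \<alpha> x \<longleftrightarrow>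
     (\<exists>C. C-lipschitz_on {t - h..T} x) \<and>
     (AE s in lebesgue. s \<in> {t<..<T} \<longrightarrow>
        (x has_vector_derivative f s (x s) (x (s - \<tau> s (x s))) (\<alpha> s)) (at s)) \<and>
     (\<forall>\<theta>\<in>{-h..0}. x (t + \<theta>) = w \<theta>)"

text \<open>
  \<open>f\<^sub>z, f\<^sub>y\<close> are the Jacobian matrices of \<open>f\<close> in its two state arguments, and \<open>\<tau>\<^sub>t, \<tau>\<^sub>z\<close> the
  partial derivatives of the delay (one-sided in time at the end points of \<open>[t0, T]\<close>).
  ``Continuously differentiable in \<open>(z, y)\<close> uniformly with respect to \<open>(t, a)\<close>'' means that the
  derivatives exist and are continuous in \<open>(z, y)\<close>, uniformly in \<open>(t, a) \<in> [t0, T] \<times> A\<close>.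
  The assumption on \<open>g\<close> forces its value to depend on \<open>w\<close> only through the
  restriction of \<open>w\<close> to \<open>[-\<tau>bar, 0]\<close>, so \<open>g\<close> is indeed a functional on that function space.
\<close>

locale delay_control_problem =
  fixes t0 T :: real
    and A :: "(real ^ 'm) set"
    and f :: "real \<Rightarrow> real ^ 'n \<Rightarrow> real ^ 'n \<Rightarrow> real ^ 'm \<Rightarrow> real ^ 'n"
    and L :: "real \<Rightarrow> real ^ 'n \<Rightarrow> real ^ 'n \<Rightarrow> real ^ 'm \<Rightarrow> real"
    and g :: "(real ^ 'n) \<times> (real \<Rightarrow> real ^ 'n) \<Rightarrow> real"
    and \<tau> :: "real \<Rightarrow> real ^ 'n \<Rightarrow> real"
    and \<tau>bar :: real
    and f\<^sub>z f\<^sub>y :: "real \<Rightarrow> real ^ 'n \<Rightarrow> real ^ 'n \<Rightarrow> real ^ 'm \<Rightarrow> real ^ 'n ^ 'n"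
    and \<tau>\<^sub>t :: "real \<Rightarrow> real ^ 'n \<Rightarrow> real"
    and \<tau>\<^sub>z :: "real \<Rightarrow> real ^ 'n \<Rightarrow> real ^ 'n"
  assumes horizon: "t0 < T"
    and control_set: "A \<noteq> {}" "convex A" "compact A"
    and f_continuous:
      "continuous_on ({t0..T} \<times> UNIV \<times> UNIV \<times> A) (\<lambda>(t, z, y, a). f t z y a)"
    and L_continuous:
      "continuous_on ({t0..T} \<times> UNIV \<times> UNIV \<times> A) (\<lambda>(t, z, y, a). L t z y a)"
    and f_lipschitz:
      "\<exists>lam>0. \<forall>t\<in>{t0..T}. \<forall>a\<in>A. \<forall>z y z' y'.
         norm (f t z y a - f t z' y' a) \<le> lam * (norm (z - z') + norm (y - y'))"
    and f_growth:
      "\<exists>C>0. \<forall>t\<in>{t0..T}. \<forall>a\<in>A. \<forall>z y. norm (f t z y a) \<le> C * (1 + norm z + norm y)"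
    and epigraph_convex:
      "\<forall>t\<in>{t0..T}. \<forall>z y. convex {(f t z y a, l) | a l. a \<in> A \<and> l \<ge> L t z y a}"
    and L_lipschitz:
      "\<forall>R>0. \<exists>lam>0. \<forall>t\<in>{t0..T}. \<forall>a\<in>A.
         \<forall>z\<in>cball 0 R. \<forall>y\<in>cball 0 R. \<forall>z'\<in>cball 0 R. \<forall>y'\<in>cball 0 R.
           \<bar>L t z y a - L t z' y' a\<bar> \<le> lam * (norm (z - z') + norm (y - y'))"
    and L_growth:
      "\<exists>C>0. \<forall>t\<in>{t0..T}. \<forall>a\<in>A. \<forall>z y. \<bar>L t z y a\<bar> \<le> C * (1 + norm z + norm y)"
    and g_lipschitz:
      "\<forall>R>0. \<exists>lam>0. \<forall>(z1, w1)\<in>X_space \<tau>bar. \<forall>(z2, w2)\<in>X_space \<tau>bar.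
         w1 \<in> P_set \<tau>bar R \<longrightarrow> w2 \<in> P_set \<tau>bar R \<longrightarrow>
           \<bar>g (z1, w1) - g (z2, w2)\<bar> \<le> lam * X_norm \<tau>bar (z1 - z2, \<lambda>\<theta>. w1 \<theta> - w2 \<theta>)"
    and delay_nonneg: "\<forall>t\<in>{t0..T}. \<forall>z. \<tau> t z \<ge> 0"
    and delay_bounded: "bdd_above ((\<lambda>(t, z). \<tau> t z) ` ({t0..T} \<times> UNIV))"
    and delay_sup: "\<tau>bar = (SUP (t, z)\<in>{t0..T} \<times> UNIV. \<tau> t z)"
    and delay_derivative:
      "\<forall>t\<in>{t0..T}. \<forall>z. ((\<lambda>(t, z). \<tau> t z) has_derivative
         (\<lambda>(k, h). \<tau>\<^sub>t t z * k + \<tau>\<^sub>z t z \<bullet> h)) (at (t, z) within {t0..T} \<times> UNIV)"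
    and delay_C1:
      "continuous_on ({t0..T} \<times> UNIV) (\<lambda>(t, z). \<tau>\<^sub>t t z)"
      "continuous_on ({t0..T} \<times> UNIV) (\<lambda>(t, z). \<tau>\<^sub>z t z)"
    and delay_lipschitz:
      "\<exists>lam>0. \<forall>t\<in>{t0..T}. \<forall>z y. \<bar>\<tau> t z - \<tau> t y\<bar> \<le> lam * norm (z - y)"
    and delay_monotone:
      "\<forall>r>0. \<exists>d>0. \<forall>t\<in>{t0..T}. \<forall>w\<in>P_set \<tau>bar r. \<forall>\<alpha>\<in>controls A t T. \<forall>x.
         is_trajectory \<tau>bar T f \<tau> t w \<alpha> x \<longrightarrow>
           (AE s in lebesgue. s \<in> {t..T} \<longrightarrow>
              1 - \<tau>\<^sub>t s (x s) - \<tau>\<^sub>z s (x s) \<bullet> vector_derivative x (at s) \<ge> d)"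
    and f_derivative:
      "\<forall>t\<in>{t0..T}. \<forall>a\<in>A. \<forall>z y. ((\<lambda>(z, y). f t z y a) has_derivative
         (\<lambda>(h, k). f\<^sub>z t z y a *v h + f\<^sub>y t z y a *v k)) (at (z, y))"
    and f_C1_uniform:
      "\<forall>z y. uniform_limit ({t0..T} \<times> A)
         (\<lambda>(z', y') (t, a). f\<^sub>z t z' y' a) (\<lambda>(t, a). f\<^sub>z t z y a) (at (z, y))"
      "\<forall>z y. uniform_limit ({t0..T} \<times> A)
         (\<lambda>(z', y') (t, a). f\<^sub>y t z' y' a) (\<lambda>(t, a). f\<^sub>y t z y a) (at (z, y))"
    and L_C1_uniform:
      "\<exists>L\<^sub>z L\<^sub>y :: real \<Rightarrow> real ^ 'n \<Rightarrow> real ^ 'n \<Rightarrow> real ^ 'm \<Rightarrow> real ^ 'n.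
         (\<forall>t\<in>{t0..T}. \<forall>a\<in>A. \<forall>z y. ((\<lambda>(z, y). L t z y a) has_derivative
            (\<lambda>(h, k). L\<^sub>z t z y a \<bullet> h + L\<^sub>y t z y a \<bullet> k)) (at (z, y))) \<and>
         (\<forall>z y. uniform_limit ({t0..T} \<times> A)
            (\<lambda>(z', y') (t, a). L\<^sub>z t z' y' a) (\<lambda>(t, a). L\<^sub>z t z y a) (at (z, y))) \<and>
         (\<forall>z y. uniform_limit ({t0..T} \<times> A)
            (\<lambda>(z', y') (t, a). L\<^sub>y t z' y' a) (\<lambda>(t, a). L\<^sub>y t z y a) (at (z, y)))"

text \<open>
  Solutions of the linearized equation along a trajectory \<open>x\<close>, with \<open>D s = s - \<tau> s (x s)\<close>.
  If \<open>D T < t\<close> then \<open>{t..D T}\<close> is empty and the last term vanishes.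
\<close>

definition is_linearized_solution ::
  "real \<Rightarrow> (real \<Rightarrow> real ^ 'n \<Rightarrow> real ^ 'n \<Rightarrow> real ^ 'm \<Rightarrow> real ^ 'n ^ 'n) \<Rightarrow>
   (real \<Rightarrow> real ^ 'n \<Rightarrow> real ^ 'n \<Rightarrow> real ^ 'm \<Rightarrow> real ^ 'n ^ 'n) \<Rightarrow>
   (real \<Rightarrow> real ^ 'n \<Rightarrow> real ^ 'n) \<Rightarrow> real \<Rightarrow> (real \<Rightarrow> real ^ 'm) \<Rightarrow>
   (real \<Rightarrow> real ^ 'n) \<Rightarrow> (real \<Rightarrow> real) \<Rightarrow> real ^ 'n \<Rightarrow> (real \<Rightarrow> real ^ 'n) \<Rightarrow> bool" where
  "is_linearized_solution T f\<^sub>z f\<^sub>y \<tau>\<^sub>z t \<alpha> x D vbar v \<longleftrightarrow>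
     (\<exists>C. C-lipschitz_on {t..T} v) \<and>
     (AE s in lebesgue. s \<in> {t<..<T} \<longrightarrow>
        (v has_vector_derivative
           f\<^sub>z s (x s) (x (D s)) (\<alpha> s) *v v s
           - (\<tau>\<^sub>z s (x s) \<bullet> v s) *\<^sub>R (f\<^sub>y s (x s) (x (D s)) (\<alpha> s) *v vector_derivative x (at (D s)))
           + indicat_real {t..D T} (D s) *\<^sub>R (f\<^sub>y s (x s) (x (D s)) (\<alpha> s) *v v (D s))) (at s)) \<and>
     v t = vbar"

end

theory Submission
  imports Defs "HOL-Complex_Analysis.Great_Picard"
begin

text \<open>
  Put \<open>y \<epsilon> = x\<epsilon> \<epsilon> - x\<close>. Gronwall's inequality gives \<open>y \<epsilon> = O(\<epsilon>)\<close>, and then the state equation bounds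
  its derivative by \<open>O(\<epsilon>)\<close> as well, so the quotients \<open>y \<epsilon> / \<epsilon>\<close> are uniformly bounded and equi-Lipschitz on
  \<open>[t, T]\<close>. By Arzela-Ascoli every sequence \<open>\<epsilon> k \<rightarrow> 0\<close> has a subsequence along which they converge uniformly to
  some \<open>v\<close>. At almost every time the chain rule identifies the limit of their derivatives with the right-hand
  side of the linearized equation along \<open>v\<close>; exceptional times are those with \<open>D s = t\<close> or with \<open>D s\<close> in the null
  set where \<open>x\<close> is not differentiable, and they are negligible because \<open>D\<close> expands distances. Dominated
  convergence turns this into the integral form of the linearized equation for \<open>v\<close>. Its solution is unique, again
  by Gronwall, so the whole family converges. Working along sequences in this way produces the solution \<open>v\<close> without
  a fixed-point argument, and the measurability of the coefficients never enters.
\<close>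

section \<open>Calculus of Lipschitz functions on the real line\<close>

text \<open>A Frechet derivative tolerates directions that vary with the step: since
  \<open>h k /\<^sub>R e k\<close> is bounded, \<open>h k\<close> tends to \<open>0\<close>, and a
  remainder that is small relative to \<open>h k\<close> is small relative to \<open>e k\<close>. In
  this form the chain rule can be applied to quotients of which only the limit is known.\<close>

lemma has_derivative_LIMSEQ_quotient:
  fixes F :: "'a::real_normed_vector \<Rightarrow> 'b::real_normed_vector"
  assumes F: "(F has_derivative F') (at z)"
    and e: "\<And>k. e k > 0" "e \<longlonglongrightarrow> 0"
    and h: "(\<lambda>k. h k /\<^sub>R e k) \<longlonglongrightarrow> H"
  shows "(\<lambda>k. (F (z + h k) - F z) /\<^sub>R e k) \<longlonglongrightarrow> F' H"
proof -
  interpret F': bounded_linear F' using F by (rule has_derivative_bounded_linear)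
  have h0: "h \<longlonglongrightarrow> 0"
  proof -
    have "(\<lambda>k. e k *\<^sub>R (h k /\<^sub>R e k)) \<longlonglongrightarrow> 0 *\<^sub>R H"
      by (intro tendsto_intros e h)
    then show ?thesis using e(1) by (simp add: less_imp_neq[symmetric])
  qed
  obtain M where M: "\<And>k. norm (h k /\<^sub>R e k) \<le> M" "M > 0"
    using h[THEN convergentI, THEN convergent_imp_Bseq] by (auto simp: Bseq_def)
  have "(\<lambda>k. (F (z + h k) - F z - F' (h k)) /\<^sub>R e k) \<longlonglongrightarrow> 0"
  proof (rule LIMSEQ_I)
    fix r :: real assume "r > 0"
    \<comment> \<open>Here \<open>M\<close> converts \<open>norm (h k)\<close> into a multiple of
      \<open>e k\<close>, and the factor \<open>2\<close> makes the final bound strict.\<close>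
    then have rM: "r / (2 * M) > 0" using M by simp
    obtain d where d: "d > 0" "\<And>y. norm (y - z) < d \<Longrightarrow> norm (F y - F z - F' (y - z)) \<le> r / (2*M) * norm (y - z)"
      using F[unfolded has_derivative_at_alt] rM by blast
    obtain N where N: "\<And>k. k \<ge> N \<Longrightarrow> norm (h k) < d"
      using LIMSEQ_D[OF h0 d(1)] by auto
    show "\<exists>no. \<forall>n\<ge>no. norm ((F (z + h n) - F z - F' (h n)) /\<^sub>R e n - 0) < r"
    proof (intro exI allI impI)
      fix n assume "n \<ge> N"
      have "norm (F (z + h n) - F z - F' (h n)) \<le> r / (2*M) * norm (h n)"
        using d(2)[of "z + h n"] N[OF \<open>n \<ge> N\<close>] by simp
      also have "norm (h n) \<le> M * e n"
        using M(1)[of n] e(1)[of n] by (simp add: field_simps)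
      finally have "norm (F (z + h n) - F z - F' (h n)) \<le> r / 2 * e n"
        using M(2) \<open>r > 0\<close> by (simp add: field_simps)
      also have "\<dots> < r * e n" using e(1)[of n] \<open>r > 0\<close> by simp
      finally have "norm (F (z + h n) - F z - F' (h n)) / e n < r"
        using e(1)[of n] by (simp add: field_simps)
      then show "norm ((F (z + h n) - F z - F' (h n)) /\<^sub>R e n - 0) < r"
        using e(1)[of n] by (simp add: divide_inverse_commute)
    qed
  qed
  moreover have "(\<lambda>k. F' (h k /\<^sub>R e k)) \<longlonglongrightarrow> F' H"
    by (rule F'.tendsto[OF h])
  ultimately have "(\<lambda>k. (F (z + h k) - F z - F' (h k)) /\<^sub>R e k + F' (h k /\<^sub>R e k)) \<longlonglongrightarrow> 0 + F' H"
    by (rule tendsto_add)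
  then show ?thesis
    by (simp add: F'.scaleR algebra_simps)
qed

text \<open>\<open>F' H\<close> is a limit of difference quotients with steps
  \<open>1 / (k + 1)\<close>, each of which obeys the bound once its point has entered
  \<open>S\<close>. This turns Lipschitz constants into bounds on the coefficients of the linearized
  equation.\<close>

lemma has_derivative_norm_le:
  fixes F :: "'a::real_normed_vector \<Rightarrow> 'b::real_normed_vector"
  assumes F: "(F has_derivative F') (at z)"
    and S: "open S" "z \<in> S"
    and lip: "\<And>y. y \<in> S \<Longrightarrow> norm (F y - F z) \<le> C * norm (y - z)"
  shows "norm (F' H) \<le> C * norm H"
proof (rule LIMSEQ_le_const2)
  let ?e = "\<lambda>k. inverse (real (Suc k))"
  have e0: "?e \<longlonglongrightarrow> 0" by (rule LIMSEQ_inverse_real_of_nat)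
  show "(\<lambda>k. norm ((F (z + ?e k *\<^sub>R H) - F z) /\<^sub>R ?e k)) \<longlonglongrightarrow> norm (F' H)"
    by (rule tendsto_norm, rule has_derivative_LIMSEQ_quotient[OF F])
       (use e0 in \<open>auto simp: field_simps\<close>)
  have "(\<lambda>k. z + ?e k *\<^sub>R H) \<longlonglongrightarrow> z + 0 *\<^sub>R H"
    by (intro tendsto_intros e0)
  then have "eventually (\<lambda>k. z + ?e k *\<^sub>R H \<in> S) sequentially"
    using S by (auto intro: topological_tendstoD)
  then obtain N where N: "\<And>k. k \<ge> N \<Longrightarrow> z + ?e k *\<^sub>R H \<in> S"
    by (auto simp: eventually_sequentially)
  show "\<exists>N. \<forall>n\<ge>N. norm ((F (z + ?e n *\<^sub>R H) - F z) /\<^sub>R ?e n) \<le> C * norm H"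
  proof (intro exI allI impI)
    fix n assume "n \<ge> N"
    have "norm (F (z + ?e n *\<^sub>R H) - F z) \<le> C * (?e n * norm H)"
      using lip[OF N[OF \<open>n \<ge> N\<close>]] by simp
    then have "norm (F (z + ?e n *\<^sub>R H) - F z) / ?e n \<le> C * norm H"
      by (simp add: field_simps)
    then show "norm ((F (z + ?e n *\<^sub>R H) - F z) /\<^sub>R ?e n) \<le> C * norm H"
      by (simp add: divide_inverse_commute)
  qed
qed

text \<open>The tags in \<open>N\<close> are controlled by a gauge witnessing that the indicator of \<open>N\<close> has integral \<open>0\<close>.\<close>

theorem fundamental_theorem_of_calculus_lipschitz:
  fixes p :: "real \<Rightarrow> 'a::euclidean_space"
  assumes ab: "a \<le> b" and lip: "L-lipschitz_on {a..b} p" and N: "negligible N"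
    and deriv: "\<And>s. s \<in> {a..b} - N \<Longrightarrow> (p has_vector_derivative p' s) (at s within {a..b})"
  shows "(p' has_integral (p b - p a)) {a..b}"
proof -
  \<comment> \<open>With the value \<open>0\<close> on \<open>N\<close>, a tag in \<open>N\<close>
    contributes just the increment of \<open>p\<close>, at most \<open>L\<close> times the length of
    its interval.\<close>
  define f where "f s = (if s \<in> N then 0 else p' s)" for s
  have L0: "L \<ge> 0" using lip by (rule lipschitz_on_nonneg)
  have "(f has_integral (p b - p a)) {a..b}"
    unfolding has_integral[of f _ a b, unfolded cbox_interval]
  proof (intro allI impI)
    fix e :: real assume e: "e > 0"
    \<comment> \<open>\<open>e1\<close> is spent on the total length \<open>b - a\<close>,
      \<open>e2\<close> on the total length of the intervals tagged in \<open>N\<close>. The added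
      \<open>1\<close> keeps the denominators positive when \<open>a = b\<close> or
      \<open>L = 0\<close> and makes both shares strictly less than \<open>e / 2\<close>.\<close>
    define e1 where "e1 = e / (2 * (b - a + 1))"
    define e2 where "e2 = e / (2 * (L + 1))"
    have e12: "e1 > 0" "e2 > 0" using e ab L0 by (auto simp: e1_def e2_def)
    have sm: "e1 * (b - a) + L * e2 < e"
    proof -
      have "e1 * (b - a) < e / 2" using e ab by (simp add: e1_def field_simps)
      moreover have "L * e2 < e / 2" using e L0 by (simp add: e2_def field_simps)
      ultimately show ?thesis by simp
    qed
    have "\<forall>x. \<exists>d>0. x \<in> {a..b} - N \<longrightarrow>
         (\<forall>y\<in>{a..b}. norm (y-x) < d \<longrightarrow> norm (p y - p x - (y-x) *\<^sub>R p' x) \<le> e1 * norm (y-x))"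
    proof
      fix x show "\<exists>d>0. x \<in> {a..b} - N \<longrightarrow>
         (\<forall>y\<in>{a..b}. norm (y-x) < d \<longrightarrow> norm (p y - p x - (y-x) *\<^sub>R p' x) \<le> e1 * norm (y-x))"
      proof (cases "x \<in> {a..b} - N")
        case True
        from deriv[OF this] e12(1) show ?thesis
          unfolding has_vector_derivative_def has_derivative_within_alt by blast
      qed (auto intro: exI[of _ 1])
    qed
    then obtain d where d: "\<And>x. 0 < d x"
      "\<And>x y. \<lbrakk>x \<in> {a..b} - N; y \<in> {a..b}; norm (y-x) < d x\<rbrakk>
              \<Longrightarrow> norm (p y - p x - (y-x) *\<^sub>R p' x) \<le> e1 * norm (y-x)"
      by metis
    have "(indicat_real N has_integral 0) (cbox a b)"
      using N by (simp add: negligible_def)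
    then obtain g where g: "gauge g" and gN: "\<And>D. D tagged_division_of (cbox a b) \<Longrightarrow> g fine D \<Longrightarrow>
          norm ((\<Sum>(x, k)\<in>D. measure lborel k *\<^sub>R indicat_real N x) - 0) < e2"
      using has_integral[of "indicat_real N" 0 a b, THEN iffD1, rule_format, OF _ e12(2)] by metis
    have gb: "gauge (\<lambda>x. ball x (d x))"
      using d(1) gauge_ball_dependent by blast
    show "\<exists>\<gamma>. gauge \<gamma> \<and> (\<forall>D. D tagged_division_of {a..b} \<and> \<gamma> fine D \<longrightarrow>
              norm ((\<Sum>(x, k)\<in>D. measure lborel k *\<^sub>R f x) - (p b - p a)) < e)"
    proof (intro exI conjI allI impI)
      show "gauge (\<lambda>x. ball x (d x) \<inter> g x)" using gb g by (rule gauge_Int)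
    next
      fix D assume "D tagged_division_of {a..b} \<and> (\<lambda>x. ball x (d x) \<inter> g x) fine D"
      then have D: "D tagged_division_of {a..b}" and fine: "(\<lambda>x. ball x (d x)) fine D" "g fine D"
        by (auto simp: fine_Int)
      have ba: "b - a = (\<Sum>(x,K)\<in>D. Sup K - Inf K)" "p b - p a = (\<Sum>(x,K)\<in>D. p(Sup K) - p(Inf K))"
        using additive_tagged_division_1[where f= "\<lambda>x. x"] additive_tagged_division_1[where f= p] ab D by auto
      have "norm (\<Sum>(x, K) \<in> D. (measure lborel K *\<^sub>R f x) - (p (Sup K) - p (Inf K)))
          \<le> (\<Sum>(x, K)\<in>D. e1 * (Sup K - Inf K) + L * (measure lborel K *\<^sub>R indicat_real N x))"
      proof (rule sum_norm_le, safe)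
        fix x K assume xK: "(x, K) \<in> D"
        then obtain u v where k: "K = cbox u v" and "x \<in> K" and kab: "K \<subseteq> {a..b}"
          using D by blast
        have "u \<le> v" using \<open>x \<in> K\<close> unfolding k by auto
        have ball: "\<forall>y\<in>K. y \<in> ball x (d x)"
          using fine(1) xK by blast
        have uv: "u \<in> K" "v \<in> K" by (simp_all add: \<open>u \<le> v\<close> k)
        have SI: "Sup K = v" "Inf K = u" "measure lborel K = v - u" using \<open>u \<le> v\<close> by (auto simp: k)
        show "norm (measure lborel K *\<^sub>R f x - (p (Sup K) - p (Inf K)))
              \<le> e1 * (Sup K - Inf K) + L * (measure lborel K *\<^sub>R indicat_real N x)"
        proof (cases "x \<in> N")
          case True
          have "norm (p v - p u) \<le> L * (v - u)"
            using lipschitz_onD[OF lip subsetD[OF kab uv(2)] subsetD[OF kab uv(1)]] \<open>u \<le> v\<close>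
            by (simp add: dist_norm)
          then show ?thesis using True e12(1) \<open>u \<le> v\<close>
            by (simp add: f_def SI norm_minus_commute add_increasing mult.commute)
        next
          case False
          have "norm ((v - u) *\<^sub>R p' x - (p v - p u)) = norm (p u - p x - (u - x) *\<^sub>R p' x - (p v - p x - (v - x) *\<^sub>R p' x))"
            by (auto simp: algebra_simps)
          also have "\<dots> \<le> norm (p u - p x - (u - x) *\<^sub>R p' x) + norm (p v - p x - (v - x) *\<^sub>R p' x)"
            by (rule norm_triangle_ineq4)
          also have "\<dots> \<le> e1 * norm (u - x) + e1 * norm (v - x)"
            using ball uv kab \<open>x \<in> K\<close> False
            by (intro add_mono d(2)) (auto simp: dist_real_def abs_minus_commute)
          also have "\<dots> = e1 * (v - u)"
            using \<open>x \<in> K\<close> by (auto simp: k algebra_simps)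
          finally show ?thesis using False by (simp add: f_def SI)
        qed
      qed
      also have "\<dots> = e1 * (b - a) + L * (\<Sum>(x, k)\<in>D. measure lborel k *\<^sub>R indicat_real N x)"
        by (simp add: ba(1) split_def sum.distrib sum_distrib_left)
      also have "\<dots> \<le> e1 * (b - a) + L * e2"
        using gN[of D] D fine(2) L0 by (intro add_left_mono mult_left_mono) (auto simp: abs_if split: if_splits)
      also have "\<dots> < e" by (rule sm)
      finally show "norm ((\<Sum>(x, k)\<in>D. measure lborel k *\<^sub>R f x) - (p b - p a)) < e"
        by (simp add: ba(2) split_def sum_subtractf)
    qed
  qed
  then show ?thesis
    by (rule has_integral_spike[OF N, rotated]) (auto simp: f_def)
qed

text \<open>The theorem on one-sided averages in the library is applied to \<open>f\<close> and to its reflection.\<close>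

theorem indefinite_integral_has_vector_derivative_ae:
  fixes f F :: "real \<Rightarrow> 'a::euclidean_space"
  assumes F: "\<And>u v. u \<le> v \<Longrightarrow> (f has_integral F v - F u) {u..v}"
  obtains N where "negligible N" "\<And>x. x \<notin> N \<Longrightarrow> (F has_vector_derivative f x) (at x)"
proof -
  have int: "f integrable_on cbox a b" for a b
    using F[of a b] by (cases "a \<le> b") (auto simp: integrable_on_def)
  have F': "((\<lambda>x. f (-x)) has_integral F (-u) - F (-v)) {u..v}" if "u \<le> v" for u v
    using F[of "-v" "-u"] that has_integral_reflect_lemma_real[of f "F (-u) - F (-v)" "-v" "-u"] by simp
  have int': "(\<lambda>x. f (-x)) integrable_on cbox a b" for a b
    using F'[of a b] by (cases "a \<le> b") (auto simp: integrable_on_def)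
  obtain N1 where N1: "negligible N1" "\<And>x e. \<lbrakk>x \<notin> N1; 0 < e\<rbrakk> \<Longrightarrow>
               \<exists>d>0. \<forall>h. 0 < h \<and> h < d \<longrightarrow>
                         norm(integral (cbox x (x + h *\<^sub>R One)) f /\<^sub>R h ^ DIM(real) - f x) < e"
    using integrable_ccontinuous_explicit[OF int] by blast
  obtain N2 where N2: "negligible N2" "\<And>x e. \<lbrakk>x \<notin> N2; 0 < e\<rbrakk> \<Longrightarrow>
               \<exists>d>0. \<forall>h. 0 < h \<and> h < d \<longrightarrow>
                         norm(integral (cbox x (x + h *\<^sub>R One)) (\<lambda>x. f (-x)) /\<^sub>R h ^ DIM(real) - f (-x)) < e"
    using integrable_ccontinuous_explicit[OF int'] by blast
  have bound: "norm (w - h *\<^sub>R c) \<le> e * h" if "norm (w /\<^sub>R h - c) < e" "h > 0" for w c :: 'a and h e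
  proof -
    have "norm (w - h *\<^sub>R c) = h * norm (w /\<^sub>R h - c)"
    proof -
      have "w - h *\<^sub>R c = h *\<^sub>R (w /\<^sub>R h - c)" using that(2) by (simp add: scaleR_diff_right)
      then show ?thesis using that(2) by simp
    qed
    then show ?thesis using that by (simp add: mult.commute less_imp_le)
  qed
  show thesis
  proof
    show "negligible (N1 \<union> uminus ` N2)"
      using N1(1) N2(1)
      by (intro negligible_Un negligible_differentiable_image_negligible) auto
    fix x assume x: "x \<notin> N1 \<union> uminus ` N2"
    then have x1: "x \<notin> N1" and x2: "-x \<notin> N2" by (auto simp: image_iff)
    show "(F has_vector_derivative f x) (at x)"
      unfolding has_vector_derivative_def has_derivative_at_alt
    proof (intro conjI allI impI)
      show "bounded_linear (\<lambda>xa. xa *\<^sub>R f x)" by (rule bounded_linear_scaleR_left)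
      fix e :: real assume e: "e > 0"
      obtain d1 where d1: "d1 > 0" "\<And>h. 0 < h \<Longrightarrow> h < d1 \<Longrightarrow> norm (integral {x..x+h} f /\<^sub>R h - f x) < e"
        using N1(2)[OF x1 e] by auto
      obtain d2 where d2: "d2 > 0" "\<And>h. 0 < h \<Longrightarrow> h < d2 \<Longrightarrow> norm (integral {-x..-x+h} (\<lambda>x. f (-x)) /\<^sub>R h - f x) < e"
        using N2(2)[OF x2 e] by auto
      show "\<exists>d>0. \<forall>y. norm (y - x) < d \<longrightarrow> norm (F y - F x - (y - x) *\<^sub>R f x) \<le> e * norm (y - x)"
      proof (intro exI[of _ "min d1 d2"] conjI allI impI)
        show "min d1 d2 > 0" using d1 d2 by simp
        fix y assume y: "norm (y - x) < min d1 d2"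
        consider "y = x" | "y > x" | "y < x" by linarith
        then show "norm (F y - F x - (y - x) *\<^sub>R f x) \<le> e * norm (y - x)"
        proof cases
          case 2
          have "integral {x..y} f = F y - F x" using F[of x y] 2 by (auto dest: integral_unique)
          then show ?thesis using d1(2)[of "y - x"] y 2 bound[where w="F y - F x" and h="y - x" and c="f x" and e=e] by simp
        next
          case 3
          have "integral {-x..-y} (\<lambda>x. f (-x)) = F x - F y" using F'[of "-x" "-y"] 3 by (auto dest: integral_unique)
          then have "norm (F x - F y - (x - y) *\<^sub>R f x) \<le> e * (x - y)"
            using d2(2)[of "x - y"] y 3 bound[where w="F x - F y" and h="x - y" and c="f x" and e=e] by simp
          moreover have "F y - F x - (y - x) *\<^sub>R f x = - (F x - F y - (x - y) *\<^sub>R f x)"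
            by (simp add: algebra_simps)
          ultimately show ?thesis using 3 by (simp only: norm_minus_cancel) simp
        qed simp
      qed
    qed
  qed
qed

text \<open>The measure \<open>E \<mapsto> \<lambda>(W E)\<close> is absolutely continuous, and its Radon-Nikodym density is the derivative.\<close>

lemma strict_mono_bilipschitz_ae_differentiable:
  fixes W :: "real \<Rightarrow> real"
  assumes lower: "\<And>u v. u \<le> v \<Longrightarrow> v - u \<le> W v - W u"
    and upper: "\<And>u v. u \<le> v \<Longrightarrow> W v - W u \<le> B * (v - u)"
  obtains N where "negligible N" "\<And>x. x \<notin> N \<Longrightarrow> W differentiable (at x)"
proof -
  have smono: "W u < W v" if "u < v" for u v using lower[of u v] that by simp
  then have inj: "inj W" by (metis injI linorder_neqE_linordered_idom order_less_irrefl)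
  have W_less_iff: "W u < W v \<longleftrightarrow> u < v" for u v
    using smono by (metis linorder_neqE_linordered_idom order_less_asym)
  have absW: "\<bar>W v - W u\<bar> \<le> B * \<bar>v - u\<bar>" "\<bar>v - u\<bar> \<le> \<bar>W v - W u\<bar>" for u v
    using upper[of u v] upper[of v u] lower[of u v] lower[of v u] by (auto simp: abs_if)
  have B: "B \<ge> 0" using absW[of 1 0] by simp
  have contW: "continuous_on UNIV W"
    by (rule lipschitz_on_continuous_on[of B]) (auto intro!: lipschitz_onI B simp: dist_norm absW)
  have surj: "\<exists>x. W x = y" for y
  proof -
    define a where "a = - \<bar>y - W 0\<bar>" define b where "b = \<bar>y - W 0\<bar>"
    have "W a \<le> y" using lower[of a 0] by (simp add: a_def)
    moreover have "y \<le> W b" using lower[of 0 b] by (simp add: b_def)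
    moreover have "a \<le> b" by (simp add: a_def b_def)
    ultimately show ?thesis
      using IVT'[of W a y b] continuous_on_subset[OF contW] by blast
  qed
  \<comment> \<open>Since \<open>W\<close> expands distances, its inverse is Lipschitz with constant
    \<open>1\<close>, hence Borel. The measure of images under \<open>W\<close> is thus the
    push-forward of Lebesgue measure along \<open>G\<close>.\<close>
  define G where "G = inv W"
  have WG: "W (G y) = y" for y using surj[of y] by (metis G_def f_inv_into_f rangeI)
  have GW: "G (W x) = x" for x using inj by (simp add: G_def)
  have contG: "continuous_on UNIV G"
    by (rule lipschitz_on_continuous_on[of 1])
       (use absW(2)[of "G _" "G _"] in \<open>auto intro!: lipschitz_onI simp: dist_norm WG\<close>)
  then have G[measurable]: "G \<in> borel_measurable borel" by (rule borel_measurable_continuous_onI)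
  define \<nu> where "\<nu> = distr lborel borel G"
  have vim: "G -` E = W ` E" for E :: "real set" using WG GW by (auto simp: image_iff) metis
  have emeasure_\<nu>: "emeasure \<nu> E = emeasure lborel (W ` E)" if "E \<in> sets borel" for E :: "real set"
    using that by (simp add: \<nu>_def emeasure_distr vim)
  \<comment> \<open>The Lipschitz bound on \<open>W\<close> acts here: Lipschitz maps send null sets
    to null sets.\<close>
  have ac: "absolutely_continuous lborel \<nu>"
    unfolding absolutely_continuous_def
  proof
    fix E :: "real set" assume E: "E \<in> null_sets lborel"
    then have Eb: "E \<in> sets borel" by auto
    have "negligible E" using E by (simp add: negligible_iff_null_sets null_sets_completionI)
    then have "negligible (W ` E)"
    proof (rule negligible_locally_Lipschitz_image[rotated])
      show "\<exists>T B. open T \<and> x \<in> T \<and> (\<forall>y\<in>E \<inter> T. norm (W y - W x) \<le> B * norm (y - x))" for x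
        by (rule exI[of _ UNIV], rule exI[of _ B]) (auto simp: absW)
    qed simp
    moreover have "W ` E \<in> sets borel" using measurable_sets[OF G, of E] Eb by (simp add: vim)
    ultimately have "emeasure lborel (W ` E) = 0"
      by (simp add: negligible_iff_emeasure0)
    then show "E \<in> null_sets \<nu>" using Eb emeasure_\<nu>[OF Eb] by (auto simp: \<nu>_def)
  qed
  obtain g where g[measurable]: "g \<in> borel_measurable lborel" and dens: "density lborel g = \<nu>"
    using sigma_finite_measure.Radon_Nikodym[OF sigma_finite_lborel ac] by (auto simp: \<nu>_def)
  have W_ivl: "W ` {u..v} = {W u..W v}" if "u \<le> v" for u v
  proof
    show "W ` {u..v} \<subseteq> {W u..W v}" using W_less_iff by (auto simp: not_less[symmetric])
    show "{W u..W v} \<subseteq> W ` {u..v}"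
    proof
      fix y assume "y \<in> {W u..W v}"
      then have "G y \<in> {u..v}" using W_less_iff[of "G y" u] W_less_iff[of v "G y"] WG by (auto simp: not_less[symmetric])
      then show "y \<in> W ` {u..v}" using WG by (metis imageI)
    qed
  qed
  have nn: "(\<integral>\<^sup>+x. g x * indicator {u..v} x \<partial>lborel) = ennreal (W v - W u)" if "u \<le> v" for u v
  proof -
    have "(\<integral>\<^sup>+x. g x * indicator {u..v} x \<partial>lborel) = emeasure \<nu> {u..v}"
      by (simp add: dens[symmetric] emeasure_density)
    also have "\<dots> = emeasure lborel {W u..W v}" using W_ivl[OF that] by (simp add: emeasure_\<nu>)
    also have "\<dots> = ennreal (W v - W u)" using lower[OF that] that by simp
    finally show ?thesis .
  qed
  have "((\<lambda>x. enn2real (g x)) has_integral W v - W u) {u..v}" if "u \<le> v" for u v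
  proof -
    \<comment> \<open>The density has values in \<open>ennreal\<close>. Its finite integral makes it
      finite almost everywhere on the interval, so \<open>enn2real\<close>, which sends infinity to
      \<open>0\<close>, alters it on a null set only.\<close>
    have fin: "AE x in lborel. g x * indicator {u..v} x \<noteq> \<infinity>"
      by (rule nn_integral_PInf_AE) (simp_all add: nn[OF that])
    have "(\<integral>\<^sup>+x. ennreal (enn2real (g x) * indicator {u..v} x) \<partial>lborel)
        = (\<integral>\<^sup>+x. g x * indicator {u..v} x \<partial>lborel)"
    proof (rule nn_integral_cong_AE)
      show "AE x in lborel. ennreal (enn2real (g x) * indicator {u..v} x) = g x * indicator {u..v} x"
        using fin by eventually_elim (auto split: split_indicator simp: less_top)
    qed
    then have "((\<lambda>x. enn2real (g x) * indicator {u..v} x) has_integral W v - W u) UNIV"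
      using nn[OF that] lower[OF that] that by (intro nn_integral_has_integral) auto
    moreover have "(\<lambda>x. enn2real (g x) * indicator {u..v} x) = (\<lambda>x. if x \<in> {u..v} then enn2real (g x) else 0)"
      by (auto simp: fun_eq_iff)
    ultimately show ?thesis
      by (simp only: has_integral_restrict_UNIV)
  qed
  then obtain N where "negligible N" "\<And>x. x \<notin> N \<Longrightarrow> (W has_vector_derivative enn2real (g x)) (at x)"
    using indefinite_integral_has_vector_derivative_ae[of "\<lambda>x. enn2real (g x)" W] by blast
  then show thesis using that by (metis differentiableI_vector)
qed

text \<open>Localization by clamping: with \<open>c\<close> the projection of the line onto
  \<open>[a, b]\<close>, the composition of \<open>F\<close> with \<open>c\<close> is an indefinite
  integral of \<open>f\<close> extended by \<open>0\<close>, and it agrees with \<open>F\<close>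
  inside the interval.\<close>

lemma indefinite_integral_has_vector_derivative_ae_interval:
  fixes f F :: "real \<Rightarrow> 'a::euclidean_space"
  assumes F: "\<And>u v. a \<le> u \<Longrightarrow> u \<le> v \<Longrightarrow> v \<le> b \<Longrightarrow> (f has_integral F v - F u) {u..v}"
  obtains N where "negligible N" "\<And>x. x \<in> {a<..<b} - N \<Longrightarrow> (F has_vector_derivative f x) (at x)"
proof (cases "a < b")
  case False
  then show thesis using that[of "{}"] by auto
next
  case True
  define c where "c = (\<lambda>s. max a (min b s))"
  define f0 where "f0 = (\<lambda>s. if s \<in> {a..b} then f s else 0)"
  have int: "(f0 has_integral F (c v) - F (c u)) {u..v}" if "u \<le> v" for u v
    unfolding f0_def has_integral_restrict_Int
  proof (cases "a \<le> v \<and> u \<le> b")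
    case True
    then have "{a..b} \<inter> {u..v} = {c u..c v}" using \<open>a < b\<close> that by (auto simp: c_def)
    moreover have "a \<le> c u" "c u \<le> c v" "c v \<le> b" using True \<open>a < b\<close> that by (auto simp: c_def)
    ultimately show "(f has_integral F (c v) - F (c u)) ({a..b} \<inter> {u..v})" using F by simp
  next
    case False
    then have "{a..b} \<inter> {u..v} = {}" "c u = c v" using \<open>a < b\<close> that by (auto simp: c_def)
    then show "(f has_integral F (c v) - F (c u)) ({a..b} \<inter> {u..v})" by simp
  qed
  obtain N where N: "negligible N" "\<And>x. x \<notin> N \<Longrightarrow> ((\<lambda>s. F (c s)) has_vector_derivative f0 x) (at x)"
    using indefinite_integral_has_vector_derivative_ae[of f0 "\<lambda>s. F (c s)"] int by blast
  show thesis
  proof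
    show "negligible N" by fact
    fix x assume x: "x \<in> {a<..<b} - N"
    then have "((\<lambda>s. F (c s)) has_vector_derivative f x) (at x)" using N(2)[of x] by (simp add: f0_def)
    then show "(F has_vector_derivative f x) (at x)"
      by (rule has_vector_derivative_transform_within_open[where S="{a<..<b}"])
         (use x in \<open>auto simp: c_def max_def min_def\<close>)
  qed
qed

text \<open>On \<open>S\<close> the map \<open>D\<close> is injective with an inverse of Lipschitz
  constant \<open>1 / d\<close>, and Lipschitz maps preserve null sets. For the delayed time this
  pulls exceptional sets back to exceptional sets of times.\<close>

lemma negligible_expanding_vimage:
  fixes D :: "real \<Rightarrow> real"
  assumes N: "negligible N" and d: "d > 0"
    and expand: "\<And>s s'. s \<in> S \<Longrightarrow> s' \<in> S \<Longrightarrow> d * \<bar>s - s'\<bar> \<le> \<bar>D s - D s'\<bar>"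
  shows "negligible {s \<in> S. D s \<in> N}"
proof -
  have inj: "inj_on D S"
  proof (rule inj_onI)
    fix s s' assume "s \<in> S" "s' \<in> S" "D s = D s'"
    then have "d * \<bar>s - s'\<bar> \<le> 0" using expand[of s s'] by simp
    then show "s = s'" using d by (simp add: mult_le_0_iff)
  qed
  define M where "M = D ` {s \<in> S. D s \<in> N}"
  have "negligible M" using N by (rule negligible_subset) (auto simp: M_def)
  then have "negligible (inv_into S D ` M)"
  proof (rule negligible_locally_Lipschitz_image[rotated])
    fix y assume "y \<in> M"
    have "norm (inv_into S D y' - inv_into S D y) \<le> (1 / d) * norm (y' - y)" if y': "y' \<in> M" for y'
    proof -
      have "y' \<in> D ` S" "y \<in> D ` S" using y' \<open>y \<in> M\<close> by (auto simp: M_def)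
      then show ?thesis
        using expand[of "inv_into S D y'" "inv_into S D y"] d
        by (simp add: inv_into_into f_inv_into_f field_simps)
    qed
    then show "\<exists>T B. open T \<and> y \<in> T \<and>
        (\<forall>y'\<in>M \<inter> T. norm (inv_into S D y' - inv_into S D y) \<le> B * norm (y' - y))"
      by (intro exI[of _ UNIV] exI[of _ "1 / d"]) auto
  qed simp
  moreover have "inv_into S D ` M = {s \<in> S. D s \<in> N}"
    using inj by (force simp: M_def image_iff)
  ultimately show ?thesis by simp
qed

text \<open>Rademacher's theorem on the line. A clamped coordinate plus a steep linear function is
  increasing and bi-Lipschitz, hence differentiable almost everywhere; subtracting the linear
  function keeps this.\<close>

theorem lipschitz_on_real_ae_differentiable:
  fixes w :: "real \<Rightarrow> 'a::euclidean_space"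
  assumes lip: "C-lipschitz_on {a..b} w"
  obtains N where "negligible N" "\<And>x. x \<in> {a<..<b} - N \<Longrightarrow> w differentiable (at x)"
proof (cases "a < b")
  case False
  then show thesis using that[of "{}"] by auto
next
  case True
  have C: "C \<ge> 0" using lip by (rule lipschitz_on_nonneg)
  define c where "c = (\<lambda>s. max a (min b s))"
  have c: "c s \<in> {a..b}" for s using True by (auto simp: c_def)
  have cd: "\<bar>c u - c v\<bar> \<le> \<bar>u - v\<bar>" for u v by (auto simp: c_def max_def min_def)
  have "\<exists>N. negligible N \<and> (\<forall>x. x \<in> {a<..<b} - N \<longrightarrow> (\<lambda>s. w s \<bullet> i) differentiable (at x))" if i: "i \<in> Basis" for i
  proof -
    \<comment> \<open>Slopes of the clamped coordinate lie in \<open>[-C, C]\<close>, so those of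
      \<open>W\<close> lie in \<open>[1, 2 * C + 1]\<close>.\<close>
    define W where "W = (\<lambda>s. w (c s) \<bullet> i + (C + 1) * s)"
    have comp: "\<bar>w (c u) \<bullet> i - w (c v) \<bullet> i\<bar> \<le> C * \<bar>u - v\<bar>" for u v
    proof -
      have "\<bar>w (c u) \<bullet> i - w (c v) \<bullet> i\<bar> \<le> norm (w (c u) - w (c v))"
        using Basis_le_norm[OF i, of "w (c u) - w (c v)"] by (simp add: inner_diff_left)
      also have "\<dots> \<le> C * \<bar>c u - c v\<bar>"
        using lipschitz_onD[OF lip c c, of u v] by (simp add: dist_norm)
      also have "\<dots> \<le> C * \<bar>u - v\<bar>" using cd C by (rule mult_left_mono)
      finally show ?thesis .
    qed
    obtain N where N: "negligible N" "\<And>x. x \<notin> N \<Longrightarrow> W differentiable (at x)"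
    proof (rule strict_mono_bilipschitz_ae_differentiable[of W "2 * C + 1"])
      fix u v :: real assume uv: "u \<le> v"
      show "v - u \<le> W v - W u" "W v - W u \<le> (2 * C + 1) * (v - u)"
        using comp[of v u] uv by (auto simp: W_def algebra_simps abs_le_iff)
    qed blast
    have "(\<lambda>s. w s \<bullet> i) differentiable (at x)" if x: "x \<in> {a<..<b} - N" for x
    proof -
      have "(\<lambda>s. W s - (C + 1) * s) differentiable (at x)"
        using N(2)[of x] x by (intro differentiable_diff) auto
      then obtain W' where "((\<lambda>s. W s - (C + 1) * s) has_derivative W') (at x)"
        by (auto simp: differentiable_def)
      then have "((\<lambda>s. w s \<bullet> i) has_derivative W') (at x)"
        by (rule has_derivative_transform_within_open[where s="{a<..<b}"])
           (use x in \<open>auto simp: W_def c_def max_def min_def\<close>)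
      then show ?thesis by (auto simp: differentiable_def)
    qed
    then show ?thesis using N by blast
  qed
  then obtain N where N: "\<And>i. i \<in> Basis \<Longrightarrow> negligible (N i)"
      "\<And>i x. i \<in> Basis \<Longrightarrow> x \<in> {a<..<b} - N i \<Longrightarrow> (\<lambda>s. w s \<bullet> i) differentiable (at x)"
    by metis
  show thesis
  proof
    show "negligible (\<Union>(N ` Basis))" using N(1) by (intro negligible_Union) auto
    show "w differentiable (at x)" if "x \<in> {a<..<b} - \<Union>(N ` Basis)" for x
      using that N(2) by (subst differentiable_componentwise_within) auto
  qed
qed

section \<open>Increment estimates from almost everywhere derivative bounds, and Gronwall's
  inequality\<close>

text \<open>For a Lipschitz function the increment is the integral of the derivative, whatever
  happens on a null set, and \<open>H\<close> dominates that derivative.\<close>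

lemma lipschitz_on_integral_bound:
  fixes p :: "real \<Rightarrow> 'a::euclidean_space"
  assumes ab: "a \<le> b" and lip: "L-lipschitz_on {a..b} p" and N: "negligible N"
    and deriv: "\<And>s. s \<in> {a<..<b} - N \<Longrightarrow> \<exists>p'. (p has_vector_derivative p') (at s) \<and> norm p' \<le> H s"
    and H: "(H has_integral I) {a..b}"
  shows "norm (p b - p a) \<le> I"
proof -
  \<comment> \<open>The end points join the exceptional set, as derivatives are given in the open
    interval only. Below, both integrands are reset on \<open>N'\<close> so that they compare at
    every point.\<close>
  define N' where "N' = N \<union> {a, b}"
  have N': "negligible N'" using N by (simp add: N'_def)
  obtain p' where p': "\<And>s. s \<in> {a<..<b} - N \<Longrightarrow> (p has_vector_derivative p' s) (at s) \<and> norm (p' s) \<le> H s"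
    using deriv by metis
  define p0 where "p0 = (\<lambda>s. if s \<in> N' then 0 else p' s)"
  define H0 where "H0 = (\<lambda>s. if s \<in> N' then 0 else H s)"
  have 1: "(p0 has_integral (p b - p a)) {a..b}"
    by (rule fundamental_theorem_of_calculus_lipschitz[OF ab lip N'])
       (use p' in \<open>auto simp: p0_def N'_def intro: has_vector_derivative_at_within\<close>)
  have 2: "(H0 has_integral I) {a..b}"
    by (rule has_integral_spike[OF N' _ H]) (auto simp: H0_def)
  have "norm (integral {a..b} p0) \<le> integral {a..b} H0"
    by (rule integral_norm_bound_integral) (use 1 2 p' in \<open>auto simp: integrable_on_def p0_def H0_def N'_def\<close>)
  then show ?thesis using 1 2 by (simp add: integral_unique)
qed

text \<open>Again the increment is the integral of the derivative; giving the integrand the value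
  \<open>c\<close> on the exceptional set keeps it at least \<open>c\<close> everywhere. This is how
  the monotone delay condition becomes expansion of the delayed time.\<close>

lemma lipschitz_on_increment_ge:
  fixes p :: "real \<Rightarrow> real"
  assumes ab: "a \<le> b" and lip: "L-lipschitz_on {a..b} p" and N: "negligible N"
    and deriv: "\<And>s. s \<in> {a<..<b} - N \<Longrightarrow> \<exists>p'. (p has_vector_derivative p') (at s) \<and> p' \<ge> c"
  shows "c * (b - a) \<le> p b - p a"
proof -
  define N' where "N' = N \<union> {a, b}"
  have N': "negligible N'" using N by (simp add: N'_def)
  obtain p' where p': "\<And>s. s \<in> {a<..<b} - N \<Longrightarrow> (p has_vector_derivative p' s) (at s) \<and> p' s \<ge> c"
    using deriv by metis
  define p0 where "p0 = (\<lambda>s. if s \<in> N' then c else p' s)"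
  have 1: "(p0 has_integral (p b - p a)) {a..b}"
    by (rule fundamental_theorem_of_calculus_lipschitz[OF ab lip N'])
       (use p' in \<open>auto simp: p0_def N'_def intro: has_vector_derivative_at_within\<close>)
  have 2: "((\<lambda>_. c) has_integral c * (b - a)) {a..b}"
    using has_integral_const_real[of c a b] ab by (simp add: mult.commute)
  show ?thesis
    by (rule has_integral_le[OF 2 1]) (use p' in \<open>auto simp: p0_def N'_def\<close>)
qed

text \<open>The delayed values enter only through the bound \<open>m\<close> on \<open>[a, s]\<close>. The proof evaluates the inequality
  where \<open>norm (p s) * exp (-2 * K * (s - a))\<close> is maximal; the doubled rate leaves half of the maximum to absorb.\<close>

lemma gronwall_delay:
  fixes p :: "real \<Rightarrow> 'a::euclidean_space"
  assumes ab: "a \<le> b" and lip: "L-lipschitz_on {a..b} p" and N: "negligible N" and K: "K > 0" and G: "G \<ge> 0"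
    and deriv: "\<And>s m. s \<in> {a<..<b} - N \<Longrightarrow> (\<And>r. r \<in> {a..s} \<Longrightarrow> norm (p r) \<le> m) \<Longrightarrow>
       \<exists>p'. (p has_vector_derivative p') (at s) \<and> norm p' \<le> K * m + G"
    and s: "s \<in> {a..b}"
  shows "norm (p s) \<le> 2 * (norm (p a) + G * (b - a)) * exp (2 * K * (b - a))"
proof -
  define c where "c = 2 * K"
  define q where "q = (\<lambda>s. norm (p s) * exp (- c * (s - a)))"
  have contp: "continuous_on {a..b} p" using lip by (rule lipschitz_on_continuous_on)
  have "continuous_on {a..b} q" unfolding q_def by (intro continuous_intros contp)
  then obtain z where z: "z \<in> {a..b}" "\<And>r. r \<in> {a..b} \<Longrightarrow> q r \<le> q z"
    using continuous_attains_sup[of "{a..b}" q] ab by auto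
  define m where "m = q z"
  have m0: "m \<ge> 0" by (simp add: m_def q_def)
  have pr: "norm (p r) \<le> m * exp (c * (r - a))" if "r \<in> {a..b}" for r
  proof -
    have "norm (p r) = q r * exp (c * (r - a))" by (simp add: q_def exp_minus)
    then show ?thesis using z(2)[OF that] by (simp add: m_def mult_right_mono)
  qed
  have pz: "norm (p z) = m * exp (c * (z - a))" by (simp add: m_def q_def exp_minus)
  \<comment> \<open>The integral over \<open>[a, z]\<close> of the derivative bound along
    \<open>m * exp (c * (s - a))\<close>; the factor \<open>1 / 2\<close> is
    \<open>K / c\<close>.\<close>
  define I where "I = m / 2 * exp (c * (z - a)) - m / 2 + G * (z - a)"
  have "norm (p z - p a) \<le> I"
  proof (rule lipschitz_on_integral_bound[where N=N and L=L and H="\<lambda>s. K * (m * exp (c * (s - a))) + G"])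
    show "a \<le> z" "negligible N" using z N by auto
    show "L-lipschitz_on {a..z} p" using z(1) by (intro lipschitz_on_subset[OF lip]) auto
    fix s assume s: "s \<in> {a<..<z} - N"
    show "\<exists>p'. (p has_vector_derivative p') (at s) \<and> norm p' \<le> K * (m * exp (c * (s - a))) + G"
    proof (rule deriv)
      show "s \<in> {a<..<b} - N" using s z by auto
      fix r assume r: "r \<in> {a..s}"
      then have "norm (p r) \<le> m * exp (c * (r - a))" using s z by (intro pr) auto
      also have "\<dots> \<le> m * exp (c * (s - a))"
        using r K m0 by (intro mult_left_mono) (auto simp: c_def)
      finally show "norm (p r) \<le> m * exp (c * (s - a))" .
    qed
  next
    have "((\<lambda>s. K * (m * exp (c * (s - a))) + G) has_integral
        (m / 2 * exp (c * (z - a)) + G * z) - (m / 2 * exp (c * (a - a)) + G * a)) {a..z}"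
    proof (rule fundamental_theorem_of_calculus)
      show "a \<le> z" using z by auto
      show "((\<lambda>s. m / 2 * exp (c * (s - a)) + G * s) has_vector_derivative
          K * (m * exp (c * (s - a))) + G) (at s within {a..z})" for s
        unfolding has_real_derivative_iff_has_vector_derivative[symmetric]
        by (auto intro!: derivative_eq_intros simp: c_def field_simps)
    qed
    then show "((\<lambda>s. K * (m * exp (c * (s - a))) + G) has_integral I) {a..z}"
      by (simp add: I_def algebra_simps)
  qed
  then have "norm (p z) \<le> norm (p a) + I" using norm_triangle_ineq2[of "p z" "p a"] by simp
  also have "\<dots> \<le> norm (p a) + m / 2 * exp (c * (z - a)) + G * (z - a)"
    using m0 by (simp add: I_def)
  \<comment> \<open>The term with \<open>m / 2\<close> is moved to the left-hand side and the
    inequality doubled.\<close>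
  finally have "m * exp (c * (z - a)) \<le> 2 * (norm (p a) + G * (z - a))" using pz by simp
  moreover have "m * 1 \<le> m * exp (c * (z - a))" using m0 z K by (intro mult_left_mono) (auto simp: c_def)
  moreover have "G * (z - a) \<le> G * (b - a)" using G z by (intro mult_left_mono) auto
  ultimately have m: "m \<le> 2 * (norm (p a) + G * (b - a))" by simp
  have "norm (p s) \<le> m * exp (c * (s - a))" by (rule pr[OF s])
  also have "\<dots> \<le> m * exp (c * (b - a))" using m0 s K by (intro mult_left_mono) (auto simp: c_def)
  also have "\<dots> \<le> 2 * (norm (p a) + G * (b - a)) * exp (c * (b - a))" using m by (intro mult_right_mono) auto
  finally show ?thesis by (simp add: c_def)
qed

section \<open>The linearized equation along a trajectory\<close>

text \<open>One reference trajectory with fixed constants: the existential bounds of the control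
  problem are instantiated once, and the monotone delay condition appears in its integrated form
  \<open>D_expand\<close>. \<open>Cx\<close> covers the history as well as the future of
  \<open>x\<close>, because delayed times reach into both.\<close>

locale delay_trajectory =
  fixes t T h :: real
    and A :: "(real ^ 'm) set"
    and f :: "real \<Rightarrow> real ^ 'n \<Rightarrow> real ^ 'n \<Rightarrow> real ^ 'm \<Rightarrow> real ^ 'n"
    and f\<^sub>z f\<^sub>y :: "real \<Rightarrow> real ^ 'n \<Rightarrow> real ^ 'n \<Rightarrow> real ^ 'm \<Rightarrow> real ^ 'n ^ 'n"
    and \<tau> :: "real \<Rightarrow> real ^ 'n \<Rightarrow> real"
    and \<tau>\<^sub>z :: "real \<Rightarrow> real ^ 'n \<Rightarrow> real ^ 'n"
    and \<alpha> :: "real \<Rightarrow> real ^ 'm"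
    and w x :: "real \<Rightarrow> real ^ 'n"
    and D :: "real \<Rightarrow> real"
    and Kf K\<tau> Cx d :: real
  assumes tT: "t \<le> T"
    and pos: "Kf > 0" "K\<tau> > 0" "Cx \<ge> 0" "d > 0"
    and f_lip: "\<And>s a z y z' y'. s \<in> {t..T} \<Longrightarrow> a \<in> A \<Longrightarrow>
       norm (f s z y a - f s z' y' a) \<le> Kf * (norm (z - z') + norm (y - y'))"
    and f_deriv: "\<And>s a z y. s \<in> {t..T} \<Longrightarrow> a \<in> A \<Longrightarrow> ((\<lambda>(z, y). f s z y a) has_derivative
         (\<lambda>(h, k). f\<^sub>z s z y a *v h + f\<^sub>y s z y a *v k)) (at (z, y))"
    and \<tau>_range: "\<And>s z. s \<in> {t..T} \<Longrightarrow> \<tau> s z \<in> {0..h}"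
    and \<tau>_lip: "\<And>s z y. s \<in> {t..T} \<Longrightarrow> \<bar>\<tau> s z - \<tau> s y\<bar> \<le> K\<tau> * norm (z - y)"
    and \<tau>_deriv: "\<And>s z. s \<in> {t..T} \<Longrightarrow> (\<tau> s has_derivative (\<lambda>k. \<tau>\<^sub>z s z \<bullet> k)) (at z)"
    and \<alpha>_in: "\<And>s. s \<in> {t<..<T} \<Longrightarrow> \<alpha> s \<in> A"
    and x_traj: "is_trajectory h T f \<tau> t w \<alpha> x"
    and x_lip: "Cx-lipschitz_on {t - h..T} x"
    and D: "\<And>s. D s = s - \<tau> s (x s)"
    and D_expand: "\<And>s s'. t \<le> s \<Longrightarrow> s \<le> s' \<Longrightarrow> s' \<le> T \<Longrightarrow> d * (s' - s) \<le> D s' - D s"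
begin

abbreviation x' where "x' s \<equiv> vector_derivative x (at s)"

definition rhs :: "(real \<Rightarrow> real ^ 'n) \<Rightarrow> real \<Rightarrow> real ^ 'n" where
  "rhs v s = f\<^sub>z s (x s) (x (D s)) (\<alpha> s) *v v s
     - (\<tau>\<^sub>z s (x s) \<bullet> v s) *\<^sub>R (f\<^sub>y s (x s) (x (D s)) (\<alpha> s) *v x' (D s))
     + indicat_real {t..D T} (D s) *\<^sub>R (f\<^sub>y s (x s) (x (D s)) (\<alpha> s) *v v (D s))"

lemma is_linearized_solution_rhs:
  "is_linearized_solution T f\<^sub>z f\<^sub>y \<tau>\<^sub>z t \<alpha> x D vbar v \<longleftrightarrow>
     (\<exists>C. C-lipschitz_on {t..T} v) \<and>
     (AE s in lebesgue. s \<in> {t<..<T} \<longrightarrow> (v has_vector_derivative rhs v s) (at s)) \<and> v t = vbar"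
  by (simp add: is_linearized_solution_def rhs_def)

lemma rhs_diff: "rhs (\<lambda>s. v s - u s) s = rhs v s - rhs u s"
  by (simp add: rhs_def matrix_vector_mult_diff_distrib inner_diff_right algebra_simps)

section \<open>Range of the delayed time and bounds on the coefficients\<close>

lemma delayed_time_range: "s \<in> {t..T} \<Longrightarrow> s - \<tau> s z \<in> {t - h..T}" "s \<in> {t..T} \<Longrightarrow> s - \<tau> s z \<le> s"
  using \<tau>_range[of s z] by auto

lemma D_range: "s \<in> {t..T} \<Longrightarrow> D s \<in> {t - h..T}" "s \<in> {t..T} \<Longrightarrow> D s \<le> s"
  using delayed_time_range[of s "x s"] by (auto simp: D)

lemma D_mono: "t \<le> s \<Longrightarrow> s \<le> s' \<Longrightarrow> s' \<le> T \<Longrightarrow> D s \<le> D s'"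
  using D_expand[of s s'] pos by (smt (verit) mult_nonneg_nonneg)

text \<open>Monotonicity gives \<open>D s \<le> D T\<close>, so the indicator tests the lower end
  only.\<close>

lemma indicator_D: "s \<in> {t..T} \<Longrightarrow> indicat_real {t..D T} (D s) = (if t \<le> D s then 1 else 0)"
  using D_mono[of s T] by auto

text \<open>The Lipschitz bound controls the total derivative, and evaluating it at
  \<open>(u, 0)\<close> and \<open>(0, u)\<close> isolates the two Jacobians. The factor
  \<open>2\<close> comes from estimating each component by the norm of the pair.\<close>

lemma f\<^sub>z_bound: "s \<in> {t..T} \<Longrightarrow> a \<in> A \<Longrightarrow> norm (f\<^sub>z s z y a *v u) \<le> 2 * Kf * norm u"
  and f\<^sub>y_bound: "s \<in> {t..T} \<Longrightarrow> a \<in> A \<Longrightarrow> norm (f\<^sub>y s z y a *v u) \<le> 2 * Kf * norm u"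
proof -
  assume sa: "s \<in> {t..T}" "a \<in> A"
  have "norm ((\<lambda>(h, k). f\<^sub>z s z y a *v h + f\<^sub>y s z y a *v k) p) \<le> 2 * Kf * norm p" for p
  proof (rule has_derivative_norm_le[OF f_deriv[OF sa] open_UNIV UNIV_I])
    fix q :: "(real ^ 'n) \<times> (real ^ 'n)"
    obtain z' y' where q: "q = (z', y')" by force
    have "norm (f s z' y' a - f s z y a) \<le> Kf * (norm (z' - z) + norm (y' - y))"
      by (rule f_lip[OF sa])
    also have "\<dots> \<le> Kf * (norm (q - (z, y)) + norm (q - (z, y)))"
      using norm_fst_le[of "z' - z" "y' - y"] norm_snd_le[of "y' - y" "z' - z"] pos
      by (intro mult_left_mono add_mono) (auto simp: q)
    finally show "norm ((case q of (z, y) \<Rightarrow> f s z y a) - (case (z, y) of (z, y) \<Rightarrow> f s z y a))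
        \<le> 2 * Kf * norm (q - (z, y))" by (simp add: q)
  qed
  from this[of "(u, 0)"] this[of "(0, u)"]
  show "norm (f\<^sub>z s z y a *v u) \<le> 2 * Kf * norm u" "norm (f\<^sub>y s z y a *v u) \<le> 2 * Kf * norm u"
    by (simp_all add: norm_Pair)
qed

lemma \<tau>\<^sub>z_bound: "s \<in> {t..T} \<Longrightarrow> \<bar>\<tau>\<^sub>z s z \<bullet> u\<bar> \<le> K\<tau> * norm u"
  using has_derivative_norm_le[OF \<tau>_deriv open_UNIV UNIV_I, of s z K\<tau> u] \<tau>_lip by simp

section \<open>Exceptional times and uniqueness for the linearized equation\<close>

text \<open>The times at which the difference quotients of the state equation can be differentiated:
  \<open>D s\<close> avoids the jump of the indicator at \<open>t\<close>, lies strictly inside the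
  domain of \<open>x\<close>, and is a point where \<open>x'\<close> is a genuine derivative and not
  a default value of \<open>vector_derivative\<close>.\<close>

definition regular_time :: "real \<Rightarrow> bool" where
  "regular_time s \<longleftrightarrow> s \<in> {t<..<T} \<and> D s \<noteq> t \<and> t - h < D s \<and> D s < T \<and>
     (x has_vector_derivative f s (x s) (x (D s)) (\<alpha> s)) (at s) \<and>
     (x has_vector_derivative x' (D s)) (at (D s))"

lemma regular_time_ae:
  obtains N where "negligible N" "\<And>s. s \<in> {t<..<T} - N \<Longrightarrow> regular_time s"
proof -
  have "AE s in lebesgue. s \<in> {t<..<T} \<longrightarrow>
        (x has_vector_derivative f s (x s) (x (s - \<tau> s (x s))) (\<alpha> s)) (at s)"
    using x_traj by (simp add: is_trajectory_def)
  then obtain N1 where N1: "negligible N1" "\<And>s. s \<in> {t<..<T} - N1 \<Longrightarrow>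
        (x has_vector_derivative f s (x s) (x (s - \<tau> s (x s))) (\<alpha> s)) (at s)"
    by (auto simp: eventually_ae_filter_negligible)
  \<comment> \<open>The state equation gives derivatives after \<open>t\<close> only; on the history
    they come from Lipschitz continuity.\<close>
  obtain N2 where N2: "negligible N2" "\<And>s. s \<in> {t - h<..<T} - N2 \<Longrightarrow> x differentiable (at s)"
    using lipschitz_on_real_ae_differentiable[OF x_lip] by blast
  define N3 where "N3 = {s \<in> {t..T}. D s \<in> insert t N2}"
  have N3: "negligible N3"
    unfolding N3_def
  proof (rule negligible_expanding_vimage)
    show "negligible (insert t N2)" using N2(1) by simp
    show "d > 0" by (rule pos)
    fix s s' assume "s \<in> {t..T}" "s' \<in> {t..T}"
    then show "d * \<bar>s - s'\<bar> \<le> \<bar>D s - D s'\<bar>"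
      using D_expand[of s s'] D_expand[of s' s] by (cases "s \<le> s'") auto
  qed
  show thesis
  proof (rule that)
    show "negligible (N1 \<union> N3)" using N1 N3 by simp
    fix s assume s: "s \<in> {t<..<T} - (N1 \<union> N3)"
    then have "s \<in> {t..T}" by auto
    note r = \<tau>_range[OF this, of "x s"]
    show "regular_time s"
      unfolding regular_time_def
    proof (intro conjI)
      show "s \<in> {t<..<T}" "D s \<noteq> t" using s by (auto simp: N3_def)
      show Dh: "t - h < D s" "D s < T" using s r by (auto simp: D)
      show "(x has_vector_derivative f s (x s) (x (D s)) (\<alpha> s)) (at s)"
        using N1(2)[of s] s by (simp add: D)
      show "(x has_vector_derivative x' (D s)) (at (D s))"
        using N2(2)[of "D s"] s Dh by (auto simp: N3_def vector_derivative_works[symmetric])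
    qed
  qed
qed

lemma x'_bound: "regular_time s \<Longrightarrow> norm (x' (D s)) \<le> Cx"
proof -
  assume r: "regular_time s"
  have "norm ((\<lambda>k. k *\<^sub>R x' (D s)) 1) \<le> Cx * norm (1::real)"
  proof (rule has_derivative_norm_le[where S="{t - h<..<T}"])
    show "(x has_derivative (\<lambda>k. k *\<^sub>R x' (D s))) (at (D s))"
      using r by (simp add: regular_time_def has_vector_derivative_def)
    show "norm (x y - x (D s)) \<le> Cx * norm (y - D s)" if "y \<in> {t - h<..<T}" for y
      using lipschitz_onD[OF x_lip, of y "D s"] that r by (auto simp: regular_time_def dist_norm)
  qed (use r in \<open>auto simp: regular_time_def\<close>)
  then show ?thesis by simp
qed

text \<open>The sum of the bounds for the three terms of \<open>rhs\<close>: \<open>2 * Kf\<close>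
  for each undelayed or delayed value of \<open>v\<close>, and \<open>2 * Kf * K\<tau> * Cx\<close>
  for the shift of the delayed time.\<close>

definition "K_rhs = 2 * Kf * (2 + K\<tau> * Cx)"

text \<open>A bound on \<open>[t, s]\<close> suffices: \<open>v (D s)\<close> either is taken in
  that interval or is multiplied by a vanishing indicator. The form matches the hypothesis of
  \<open>gronwall_delay\<close>.\<close>

lemma rhs_bound:
  assumes s: "regular_time s" and m: "\<And>r. r \<in> {t..s} \<Longrightarrow> norm (v r) \<le> m"
  shows "norm (rhs v s) \<le> K_rhs * m"
proof -
  have s': "s \<in> {t..T}" "\<alpha> s \<in> A" using s \<alpha>_in by (auto simp: regular_time_def)
  have vs: "norm (v s) \<le> m" using m s' by simp
  have m0: "m \<ge> 0" using vs norm_ge_zero order_trans by blast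
  have 1: "norm (f\<^sub>z s (x s) (x (D s)) (\<alpha> s) *v v s) \<le> 2 * Kf * m"
    using f\<^sub>z_bound[OF s', of "x s" "x (D s)" "v s"] vs pos by (smt (verit) mult_left_mono)
  have "norm ((\<tau>\<^sub>z s (x s) \<bullet> v s) *\<^sub>R (f\<^sub>y s (x s) (x (D s)) (\<alpha> s) *v x' (D s)))
      = \<bar>\<tau>\<^sub>z s (x s) \<bullet> v s\<bar> * norm (f\<^sub>y s (x s) (x (D s)) (\<alpha> s) *v x' (D s))" by simp
  also have "\<dots> \<le> (K\<tau> * norm (v s)) * (2 * Kf * norm (x' (D s)))"
    using pos by (intro mult_mono \<tau>\<^sub>z_bound f\<^sub>y_bound s') auto
  also have "\<dots> \<le> (K\<tau> * m) * (2 * Kf * Cx)"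
    using pos vs m0 x'_bound[OF s] by (intro mult_mono mult_left_mono) auto
  finally have 2: "norm ((\<tau>\<^sub>z s (x s) \<bullet> v s) *\<^sub>R (f\<^sub>y s (x s) (x (D s)) (\<alpha> s) *v x' (D s)))
      \<le> (K\<tau> * m) * (2 * Kf * Cx)" .
  have 3: "norm (indicat_real {t..D T} (D s) *\<^sub>R (f\<^sub>y s (x s) (x (D s)) (\<alpha> s) *v v (D s))) \<le> 2 * Kf * m"
  proof (cases "t \<le> D s")
    case True
    then have "norm (v (D s)) \<le> m" using m D_range[OF s'(1)] by simp
    then have "norm (f\<^sub>y s (x s) (x (D s)) (\<alpha> s) *v v (D s)) \<le> 2 * Kf * m"
      using f\<^sub>y_bound[OF s', of "x s" "x (D s)" "v (D s)"] pos by (smt (verit) mult_left_mono)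
    then show ?thesis using True indicator_D[OF s'(1)] by simp
  next
    case False
    then show ?thesis using indicator_D[OF s'(1)] m0 pos by simp
  qed
  have "norm (rhs v s) \<le> 2 * Kf * m + (K\<tau> * m) * (2 * Kf * Cx) + 2 * Kf * m"
    unfolding rhs_def by (intro norm_triangle_le add_mono norm_triangle_le_diff 1 2 3)
  also have "\<dots> = K_rhs * m" by (simp add: K_rhs_def algebra_simps)
  finally show ?thesis .
qed

text \<open>By linearity the difference of two solutions solves the same equation with initial value
  \<open>0\<close>, and Gronwall without inhomogeneity forces it to vanish.\<close>

lemma linearized_solution_unique:
  assumes v: "is_linearized_solution T f\<^sub>z f\<^sub>y \<tau>\<^sub>z t \<alpha> x D vbar v"
    and u: "is_linearized_solution T f\<^sub>z f\<^sub>y \<tau>\<^sub>z t \<alpha> x D vbar u"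
    and s: "s \<in> {t..T}"
  shows "v s = u s"
proof -
  obtain C1 C2 where C: "C1-lipschitz_on {t..T} v" "C2-lipschitz_on {t..T} u"
    using u v by (auto simp: is_linearized_solution_def)
  have ae: "AE s in lebesgue. s \<in> {t<..<T} \<longrightarrow> (v has_vector_derivative rhs v s) (at s) \<and>
      (u has_vector_derivative rhs u s) (at s)"
    using u v by (auto simp: is_linearized_solution_rhs elim: AE_mp)
  then obtain N1 where N1: "negligible N1" "\<And>s. s \<in> {t<..<T} - N1 \<Longrightarrow>
      (v has_vector_derivative rhs v s) (at s) \<and> (u has_vector_derivative rhs u s) (at s)"
    by (auto simp: eventually_ae_filter_negligible)
  obtain N2 where N2: "negligible N2" "\<And>s. s \<in> {t<..<T} - N2 \<Longrightarrow> regular_time s"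
    using regular_time_ae by blast
  have "norm (v s - u s) \<le> 2 * (norm (v t - u t) + 0 * (T - t)) * exp (2 * K_rhs * (T - t))"
  proof (rule gronwall_delay[OF tT _ _ _ _ _ s])
    show "(C1 + C2)-lipschitz_on {t..T} (\<lambda>s. v s - u s)" by (intro lipschitz_on_diff C)
    show "negligible (N1 \<union> N2)" using N1 N2 by simp
    show "K_rhs > 0" using pos by (simp add: K_rhs_def add_pos_nonneg)
    fix r m assume r: "r \<in> {t<..<T} - (N1 \<union> N2)" and m: "\<And>q. q \<in> {t..r} \<Longrightarrow> norm (v q - u q) \<le> m"
    show "\<exists>p'. ((\<lambda>s. v s - u s) has_vector_derivative p') (at r) \<and> norm p' \<le> K_rhs * m + 0"
    proof (intro exI conjI)
      show "((\<lambda>s. v s - u s) has_vector_derivative rhs (\<lambda>s. v s - u s) r) (at r)"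
        unfolding rhs_diff using N1(2)[of r] r by (intro has_vector_derivative_diff) auto
      show "norm (rhs (\<lambda>s. v s - u s) r) \<le> K_rhs * m + 0"
        using rhs_bound[of r "\<lambda>s. v s - u s" m] N2(2)[of r] r m by auto
    qed
  qed simp
  then show ?thesis using u v by (simp add: is_linearized_solution_def)
qed

subsection \<open>Perturbed trajectories\<close>

definition "K_pert = Kf * (2 + Cx * K\<tau>)"

text \<open>The Gronwall constant for initial size \<open>C\<close> and inhomogeneity
  \<open>Kf * C\<close>; it multiplies the size \<open>e\<close> of the perturbation.\<close>

definition "C_pert C = 2 * (C + Kf * C * (T - t)) * exp (2 * K_pert * (T - t))"

lemma K_pert_pos: "K_pert > 0"
  using pos by (simp add: K_pert_def add_pos_nonneg)

lemma C_pert_nonneg: "C \<ge> 0 \<Longrightarrow> C_pert C \<ge> 0"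
  using pos tT by (simp add: C_pert_def)

text \<open>Two effects are separated at the perturbed delayed time: the deviation of
  \<open>X\<close> from \<open>x\<close> there, and the movement of \<open>x\<close> caused by the
  shift of the delayed time itself.\<close>

lemma delayed_state_diff:
  assumes s: "s \<in> {t..T}"
  shows "norm (X (s - \<tau> s (X s)) - x (D s))
    \<le> norm (X (s - \<tau> s (X s)) - x (s - \<tau> s (X s))) + Cx * K\<tau> * norm (X s - x s)"
proof -
  have "norm (x (s - \<tau> s (X s)) - x (D s)) \<le> Cx * \<bar>\<tau> s (X s) - \<tau> s (x s)\<bar>"
    using lipschitz_onD[OF x_lip delayed_time_range(1)[OF s] D_range(1)[OF s], of "X s"]
    by (simp add: dist_norm D abs_minus_commute)
  also have "\<dots> \<le> Cx * (K\<tau> * norm (X s - x s))"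
    using pos s by (intro mult_left_mono \<tau>_lip) auto
  finally have "norm (x (s - \<tau> s (X s)) - x (D s)) \<le> Cx * K\<tau> * norm (X s - x s)" by simp
  then show ?thesis
    using norm_triangle_ineq[of "X (s - \<tau> s (X s)) - x (s - \<tau> s (X s))" "x (s - \<tau> s (X s)) - x (D s)"] by simp
qed

lemma perturbed_derivative_bound:
  assumes s: "s \<in> {t<..<T}"
    and hist: "\<And>r. r \<in> {t - h..t} \<Longrightarrow> norm (X r - x r) \<le> B"
    and m: "\<And>r. r \<in> {t..s} \<Longrightarrow> norm (X r - x r) \<le> m"
  shows "norm (f s (X s) (X (s - \<tau> s (X s))) (\<alpha> s) - f s (x s) (x (D s)) (\<alpha> s)) \<le> K_pert * m + Kf * B"
proof -
  have s': "s \<in> {t..T}" using s by auto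
  let ?r = "s - \<tau> s (X s)"
  have ms: "norm (X s - x s) \<le> m" using m s by simp
  have m0: "m \<ge> 0" using ms norm_ge_zero order_trans by blast
  have h0: "h \<ge> 0" using \<tau>_range[OF s', of 0] by simp
  have "norm (X t - x t) \<le> B" using hist[of t] h0 by simp
  then have B0: "B \<ge> 0" using norm_ge_zero[of "X t - x t"] by linarith
  \<comment> \<open>The delayed time falls either after \<open>t\<close>, where \<open>m\<close>
    applies, or into the history, where \<open>B\<close> applies; the sum covers both.\<close>
  have r: "norm (X ?r - x ?r) \<le> m + B"
  proof (cases "t \<le> ?r")
    case True
    then have "norm (X ?r - x ?r) \<le> m" using delayed_time_range(2)[OF s'] by (intro m) auto
    then show ?thesis using B0 by simp
  next
    case False
    then have "norm (X ?r - x ?r) \<le> B" using delayed_time_range(1)[OF s', of "X s"] by (intro hist) auto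
    then show ?thesis using m0 by simp
  qed
  have "Cx * K\<tau> * norm (X s - x s) \<le> Cx * K\<tau> * m" using ms pos by (intro mult_left_mono) auto
  then have delay: "norm (X ?r - x (D s)) \<le> (m + B) + Cx * K\<tau> * m"
    using delayed_state_diff[OF s', of X] r by linarith
  have "norm (f s (X s) (X ?r) (\<alpha> s) - f s (x s) (x (D s)) (\<alpha> s))
      \<le> Kf * (norm (X s - x s) + norm (X ?r - x (D s)))"
    by (rule f_lip[OF s' \<alpha>_in[OF s]])
  also have "\<dots> \<le> Kf * (m + ((m + B) + Cx * K\<tau> * m))"
    using pos ms delay by (intro mult_left_mono add_mono) auto
  also have "\<dots> = K_pert * m + Kf * B" by (simp add: K_pert_def algebra_simps)
  finally show ?thesis .
qed

text \<open>Gronwall first bounds the deviation by a multiple of \<open>e\<close>. Reinserting this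
  bound into the state equation makes its derivative of order \<open>e\<close>, and integration
  yields a Lipschitz constant of order \<open>e\<close>.\<close>

lemma perturbed_trajectory:
  assumes X: "is_trajectory h T f \<tau> t (\<lambda>\<theta>. w \<theta> + \<omega> \<theta>) \<alpha> X"
    and \<omega>: "\<And>\<theta>. \<theta> \<in> {-h..0} \<Longrightarrow> norm (\<omega> \<theta>) \<le> C * e"
    and e: "e \<ge> 0" and C: "C \<ge> 0" and h: "h \<ge> 0"
  obtains N where "negligible N"
    and "\<And>s. s \<in> {t<..<T} - N \<Longrightarrow> regular_time s \<and> ((\<lambda>s. X s - x s) has_vector_derivative
       f s (X s) (X (s - \<tau> s (X s))) (\<alpha> s) - f s (x s) (x (D s)) (\<alpha> s)) (at s)"
    and "\<And>s. s \<in> {t<..<T} \<Longrightarrow>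
       norm (f s (X s) (X (s - \<tau> s (X s))) (\<alpha> s) - f s (x s) (x (D s)) (\<alpha> s)) \<le> (K_pert * C_pert C + Kf * C) * e"
    and "\<And>r. r \<in> {t - h..t} \<Longrightarrow> X r - x r = \<omega> (r - t)"
    and "\<And>s. s \<in> {t..T} \<Longrightarrow> norm (X s - x s) \<le> C_pert C * e"
    and "((K_pert * C_pert C + Kf * C) * e)-lipschitz_on {t..T} (\<lambda>s. X s - x s)"
proof -
  define y where "y = (\<lambda>s. X s - x s)"
  define y' where "y' = (\<lambda>s. f s (X s) (X (s - \<tau> s (X s))) (\<alpha> s) - f s (x s) (x (D s)) (\<alpha> s))"
  have hist: "X r - x r = \<omega> (r - t)" if "r \<in> {t - h..t}" for r
  proof -
    have "r - t \<in> {-h..0}" using that by auto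
    then have "X (t + (r - t)) = w (r - t) + \<omega> (r - t)" "x (t + (r - t)) = w (r - t)"
      using X x_traj unfolding is_trajectory_def by blast+
    then show ?thesis by simp
  qed
  have histb: "norm (X r - x r) \<le> C * e" if "r \<in> {t - h..t}" for r
    using hist[OF that] \<omega>[of "r - t"] that by auto
  obtain CX where CX: "CX-lipschitz_on {t - h..T} X" using X by (auto simp: is_trajectory_def)
  \<comment> \<open>This constant does not shrink with \<open>e\<close>; it only makes the integral
    estimates applicable until the sharp one is available.\<close>
  have lipy: "(CX + Cx)-lipschitz_on {t..T} y"
    unfolding y_def using h by (intro lipschitz_on_diff lipschitz_on_subset[OF CX] lipschitz_on_subset[OF x_lip]) auto
  have "AE s in lebesgue. s \<in> {t<..<T} \<longrightarrow>
        (X has_vector_derivative f s (X s) (X (s - \<tau> s (X s))) (\<alpha> s)) (at s)"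
    using X by (simp add: is_trajectory_def)
  then obtain N1 where N1: "negligible N1" "\<And>s. s \<in> {t<..<T} - N1 \<Longrightarrow>
        (X has_vector_derivative f s (X s) (X (s - \<tau> s (X s))) (\<alpha> s)) (at s)"
    by (auto simp: eventually_ae_filter_negligible)
  obtain N2 where N2: "negligible N2" "\<And>s. s \<in> {t<..<T} - N2 \<Longrightarrow> regular_time s"
    using regular_time_ae by blast
  have N: "negligible (N1 \<union> N2)" using N1 N2 by simp
  have der: "regular_time s \<and> (y has_vector_derivative y' s) (at s)" if "s \<in> {t<..<T} - (N1 \<union> N2)" for s
    using N1(2)[of s] N2(2)[of s] that unfolding y_def y'_def
    by (auto intro: has_vector_derivative_diff simp: regular_time_def)
  have bound: "norm (y s) \<le> C_pert C * e" if s: "s \<in> {t..T}" for s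
  proof -
    have "norm (y s) \<le> 2 * (norm (y t) + Kf * (C * e) * (T - t)) * exp (2 * K_pert * (T - t))"
    proof (rule gronwall_delay[OF tT lipy N K_pert_pos _ _ s])
      show "0 \<le> Kf * (C * e)" using pos C e by simp
      fix r m assume r: "r \<in> {t<..<T} - (N1 \<union> N2)" and m: "\<And>q. q \<in> {t..r} \<Longrightarrow> norm (y q) \<le> m"
      show "\<exists>p'. (y has_vector_derivative p') (at r) \<and> norm p' \<le> K_pert * m + Kf * (C * e)"
        using der[OF r] perturbed_derivative_bound[of r X "C * e" m] r m histb
        unfolding y'_def y_def by blast
    qed
    also have "\<dots> \<le> 2 * (C * e + Kf * (C * e) * (T - t)) * exp (2 * K_pert * (T - t))"
      using histb[of t] h by (simp add: y_def)
    also have "\<dots> = C_pert C * e" by (simp add: C_pert_def algebra_simps)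
    finally show ?thesis .
  qed
  have bound': "norm (y' s) \<le> (K_pert * C_pert C + Kf * C) * e" if s: "s \<in> {t<..<T}" for s
  proof -
    have "norm (y' s) \<le> K_pert * (C_pert C * e) + Kf * (C * e)"
      unfolding y'_def using s bound histb by (intro perturbed_derivative_bound) (auto simp: y_def)
    then show ?thesis by (simp add: algebra_simps)
  qed
  define M where "M = (K_pert * C_pert C + Kf * C) * e"
  have M0: "M \<ge> 0" using K_pert_pos C_pert_nonneg[OF C] C e pos by (simp add: M_def)
  have incr: "norm (y b - y a) \<le> M * (b - a)" if "t \<le> a" "a \<le> b" "b \<le> T" for a b
  proof (rule lipschitz_on_integral_bound[OF that(2) _ N, where H="\<lambda>_. M"])
    show "(CX + Cx)-lipschitz_on {a..b} y" using that by (intro lipschitz_on_subset[OF lipy]) auto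
    show "\<exists>p'. (y has_vector_derivative p') (at s) \<and> norm p' \<le> M" if "s \<in> {a<..<b} - (N1 \<union> N2)" for s
      using der[of s] bound'[of s] that \<open>t \<le> a\<close> \<open>b \<le> T\<close> by (auto simp: M_def)
    show "((\<lambda>_. M) has_integral M * (b - a)) {a..b}"
      using has_integral_const_real[of M a b] that by (simp add: mult.commute)
  qed
  have lip: "M-lipschitz_on {t..T} y"
  proof (rule lipschitz_onI[OF _ M0])
    fix a b assume "a \<in> {t..T}" "b \<in> {t..T}"
    then show "dist (y a) (y b) \<le> M * dist a b"
      using incr[of a b] incr[of b a] by (cases "a \<le> b") (auto simp: dist_norm norm_minus_commute)
  qed
  show thesis
    using that[OF N] der bound' hist bound lip unfolding y_def y'_def M_def by blast
qed

text \<open>For small \<open>e j\<close> the delayed argument of the perturbed trajectory falls on the same side of \<open>t\<close> as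
  \<open>D s\<close>; on the left side it leaves the support of the perturbation, hence the indicator in \<open>rhs\<close>.\<close>

lemma quotient_derivative_limit:
  assumes s: "regular_time s"
    and e: "\<And>j. e j > 0" "e \<longlonglongrightarrow> 0"
    and lip: "\<And>j. (C2 * e j)-lipschitz_on {t..T} (\<lambda>s. X j s - x s)"
    and supp: "\<And>j r. r \<in> {t - h..<t - e j} \<Longrightarrow> X j r = x r"
    and conv: "\<And>r. r \<in> {t..T} \<Longrightarrow> (\<lambda>j. (X j r - x r) /\<^sub>R e j) \<longlonglongrightarrow> v r"
  shows "(\<lambda>j. (f s (X j s) (X j (s - \<tau> s (X j s))) (\<alpha> s) - f s (x s) (x (D s)) (\<alpha> s)) /\<^sub>R e j) \<longlonglongrightarrow> rhs v s"
proof -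
  have s': "s \<in> {t..T}" "\<alpha> s \<in> A" using s \<alpha>_in by (auto simp: regular_time_def)
  define Dj where "Dj = (\<lambda>j. s - \<tau> s (X j s))"
  have Dj_range: "Dj j \<in> {t - h..T}" "Dj j \<le> s" for j
    using delayed_time_range[OF s'(1), of "X j s"] by (auto simp: Dj_def)
  define i where "i = indicat_real {t..D T} (D s)"
  have i: "i = (if t \<le> D s then 1 else 0)" using indicator_D[OF s'(1)] by (simp add: i_def)
  have l1: "(\<lambda>j. (X j s - x s) /\<^sub>R e j) \<longlonglongrightarrow> v s" by (rule conv[OF s'(1)])
  have "(\<lambda>j. (\<tau> s (x s + (X j s - x s)) - \<tau> s (x s)) /\<^sub>R e j) \<longlonglongrightarrow> \<tau>\<^sub>z s (x s) \<bullet> v s"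
    by (rule has_derivative_LIMSEQ_quotient[OF \<tau>_deriv[OF s'(1)] e l1])
  from tendsto_minus[OF this]
  have l2: "(\<lambda>j. (Dj j - D s) /\<^sub>R e j) \<longlonglongrightarrow> - (\<tau>\<^sub>z s (x s) \<bullet> v s)"
    by (simp add: Dj_def D algebra_simps)
  have "(x has_derivative (\<lambda>k. k *\<^sub>R x' (D s))) (at (D s))"
    using s by (simp add: regular_time_def has_vector_derivative_def)
  \<comment> \<open>The first-order shift of the delayed time, found in \<open>l2\<close>, is the
    direction in which \<open>x\<close> is differentiated at \<open>D s\<close>.\<close>
  from has_derivative_LIMSEQ_quotient[OF this e l2]
  have l3: "(\<lambda>j. (x (Dj j) - x (D s)) /\<^sub>R e j) \<longlonglongrightarrow> - (\<tau>\<^sub>z s (x s) \<bullet> v s) *\<^sub>R x' (D s)" by simp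
  have "(\<lambda>j. e j *\<^sub>R ((Dj j - D s) /\<^sub>R e j)) \<longlonglongrightarrow> 0 *\<^sub>R (- (\<tau>\<^sub>z s (x s) \<bullet> v s))"
    by (intro tendsto_intros e l2)
  moreover have "e j *\<^sub>R ((Dj j - D s) /\<^sub>R e j) = Dj j - D s" for j using e(1)[of j] by simp
  ultimately have "(\<lambda>j. Dj j - D s) \<longlonglongrightarrow> 0" by (simp only: scaleR_zero_left)
  then have Dj_lim: "Dj \<longlonglongrightarrow> D s" by (simp add: LIM_zero_iff)
  have l4: "(\<lambda>j. (X j (Dj j) - x (Dj j)) /\<^sub>R e j) \<longlonglongrightarrow> i *\<^sub>R v (D s)"
  proof (cases "t \<le> D s")
    case True
    then have Ds: "t < D s" "D s \<in> {t..T}" using s by (auto simp: regular_time_def)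
    \<comment> \<open>The deviation has a Lipschitz constant of order \<open>e j\<close>, so after
      division by \<open>e j\<close> the evaluation point can be moved from \<open>Dj j\<close> to
      \<open>D s\<close> at vanishing cost.\<close>
    have "(\<lambda>j. (X j (Dj j) - x (Dj j)) /\<^sub>R e j - (X j (D s) - x (D s)) /\<^sub>R e j) \<longlonglongrightarrow> 0"
    proof (rule Lim_null_comparison)
      show "(\<lambda>j. C2 * \<bar>Dj j - D s\<bar>) \<longlonglongrightarrow> 0"
        using Dj_lim by (auto intro!: tendsto_eq_intros simp: LIM_zero_iff)
      have "eventually (\<lambda>j. Dj j > t) sequentially" using Dj_lim Ds(1) by (rule order_tendstoD)
      then show "eventually (\<lambda>j. norm ((X j (Dj j) - x (Dj j)) /\<^sub>R e j - (X j (D s) - x (D s)) /\<^sub>R e j) \<le> C2 * \<bar>Dj j - D s\<bar>) sequentially"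
      proof eventually_elim
        case (elim j)
        have "norm ((X j (Dj j) - x (Dj j)) - (X j (D s) - x (D s))) \<le> C2 * e j * \<bar>Dj j - D s\<bar>"
          using lipschitz_onD[OF lip[of j], of "Dj j" "D s"] elim Dj_range[of j] Ds by (simp add: dist_norm)
        then have "inverse (e j) * norm ((X j (Dj j) - x (Dj j)) - (X j (D s) - x (D s))) \<le> C2 * \<bar>Dj j - D s\<bar>"
          using e(1)[of j] by (simp add: field_simps)
        then show ?case using e(1)[of j] by (simp add: scaleR_diff_right[symmetric])
      qed
    qed
    from tendsto_add[OF this conv[OF Ds(2)]] show ?thesis using True by (simp add: i)
  next
    case False
    have "(\<lambda>j. Dj j + e j) \<longlonglongrightarrow> D s + 0" by (intro tendsto_intros Dj_lim e)
    then have "eventually (\<lambda>j. Dj j + e j < t) sequentially" using False by (intro order_tendstoD) auto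
    then have "eventually (\<lambda>j. (X j (Dj j) - x (Dj j)) /\<^sub>R e j = 0) sequentially"
    proof eventually_elim
      case (elim j)
      then show ?case using supp[of "Dj j" j] Dj_range[of j] by simp
    qed
    then show ?thesis using False by (simp add: i tendsto_eventually)
  qed
  \<comment> \<open>The difference is split at \<open>x (Dj j)\<close>: \<open>l4\<close> gives the
    effect of the perturbed state, \<open>l3\<close> that of the shifted delayed time.\<close>
  have l5: "(\<lambda>j. (X j (Dj j) - x (D s)) /\<^sub>R e j) \<longlonglongrightarrow> i *\<^sub>R v (D s) + - (\<tau>\<^sub>z s (x s) \<bullet> v s) *\<^sub>R x' (D s)"
    using tendsto_add[OF l4 l3] by (simp add: scaleR_diff_right)
  have "(\<lambda>j. (X j s - x s, X j (Dj j) - x (D s)) /\<^sub>R e j) \<longlonglongrightarrow>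
      (v s, i *\<^sub>R v (D s) + - (\<tau>\<^sub>z s (x s) \<bullet> v s) *\<^sub>R x' (D s))"
    using tendsto_Pair[OF l1 l5] by simp
  from has_derivative_LIMSEQ_quotient[OF f_deriv[OF s', of "x s" "x (D s)"] e this]
  have "(\<lambda>j. (f s (X j s) (X j (Dj j)) (\<alpha> s) - f s (x s) (x (D s)) (\<alpha> s)) /\<^sub>R e j) \<longlonglongrightarrow>
     f\<^sub>z s (x s) (x (D s)) (\<alpha> s) *v v s
     + f\<^sub>y s (x s) (x (D s)) (\<alpha> s) *v (i *\<^sub>R v (D s) + - (\<tau>\<^sub>z s (x s) \<bullet> v s) *\<^sub>R x' (D s))"
    by simp
  also have "f\<^sub>z s (x s) (x (D s)) (\<alpha> s) *v v s
     + f\<^sub>y s (x s) (x (D s)) (\<alpha> s) *v (i *\<^sub>R v (D s) + - (\<tau>\<^sub>z s (x s) \<bullet> v s) *\<^sub>R x' (D s)) = rhs v s"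
    by (simp add: rhs_def i_def[symmetric] matrix_vector_mult_diff_distrib matrix_vector_mult_scaleR)
  finally show ?thesis by (simp add: Dj_def)
qed

text \<open>Compactness yields a limit along a subsequence only; uniqueness removes this restriction
  later. The limit is taken in the increments \<open>v b - v a\<close>, since the derivatives
  converge merely pointwise.\<close>

theorem quotients_converge_along_subsequence:
  assumes X: "\<And>k. is_trajectory h T f \<tau> t (\<lambda>\<theta>. w \<theta> + \<omega> k \<theta>) \<alpha> (X k)"
    and \<omega>: "\<And>k \<theta>. \<theta> \<in> {-h..0} \<Longrightarrow> norm (\<omega> k \<theta>) \<le> C * e k"
    and supp: "\<And>k \<theta>. \<theta> \<in> {-h..0} \<Longrightarrow> \<theta> < - e k \<Longrightarrow> \<omega> k \<theta> = 0"
    and init: "(\<lambda>k. \<omega> k 0 /\<^sub>R e k) \<longlonglongrightarrow> vbar"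
    and e: "\<And>k. e k > 0" "e \<longlonglongrightarrow> 0"
    and C: "C \<ge> 0" and h: "h \<ge> 0"
  obtains r v where "strict_mono r" "is_linearized_solution T f\<^sub>z f\<^sub>y \<tau>\<^sub>z t \<alpha> x D vbar v"
    "uniform_limit {t..T} (\<lambda>j s. (X (r j) s - x s) /\<^sub>R e (r j)) v sequentially"
proof -
  define y' where "y' = (\<lambda>k s. f s (X k s) (X k (s - \<tau> s (X k s))) (\<alpha> s) - f s (x s) (x (D s)) (\<alpha> s))"
  define C1 where "C1 = C_pert C"
  define C2 where "C2 = K_pert * C1 + Kf * C"
  have C2: "C2 \<ge> 0" using K_pert_pos C_pert_nonneg[OF C] C pos by (simp add: C1_def C2_def)
  have "\<forall>k. \<exists>N. negligible N \<and>
    (\<forall>s \<in> {t<..<T} - N. regular_time s \<and> ((\<lambda>s. X k s - x s) has_vector_derivative y' k s) (at s)) \<and>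
    (\<forall>s \<in> {t<..<T}. norm (y' k s) \<le> C2 * e k) \<and> (\<forall>r \<in> {t - h..t}. X k r - x r = \<omega> k (r - t)) \<and>
    (\<forall>s \<in> {t..T}. norm (X k s - x s) \<le> C1 * e k) \<and> (C2 * e k)-lipschitz_on {t..T} (\<lambda>s. X k s - x s)"
    (is "\<forall>k. \<exists>N. ?P k N")
  proof
    fix k
    show "\<exists>N. ?P k N"
      by (rule perturbed_trajectory[OF X \<omega> _ C h, of k])
         (use e in \<open>auto simp: y'_def C1_def C2_def less_imp_le\<close>)
  qed
  from choice[OF this] obtain N where N0: "\<forall>k. ?P k (N k)" ..
  then have N: "\<And>k. negligible (N k)"
    and der: "\<And>k s. s \<in> {t<..<T} - N k \<Longrightarrow> regular_time s \<and> ((\<lambda>s. X k s - x s) has_vector_derivative y' k s) (at s)"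
    and y'_bound: "\<And>k s. s \<in> {t<..<T} \<Longrightarrow> norm (y' k s) \<le> C2 * e k"
    and hist: "\<And>k r. r \<in> {t - h..t} \<Longrightarrow> X k r - x r = \<omega> k (r - t)"
    and bound: "\<And>k s. s \<in> {t..T} \<Longrightarrow> norm (X k s - x s) \<le> C1 * e k"
    and lip: "\<And>k. (C2 * e k)-lipschitz_on {t..T} (\<lambda>s. X k s - x s)"
    by blast+
  define q where "q = (\<lambda>k s. (X k s - x s) /\<^sub>R e k)"
  have q_diff: "norm (q k a - q k b) \<le> C2 * \<bar>a - b\<bar>" if "a \<in> {t..T}" "b \<in> {t..T}" for k a b
  proof -
    have "norm ((X k a - x a) - (X k b - x b)) \<le> C2 * e k * \<bar>a - b\<bar>"
      using lipschitz_onD[OF lip that, of k] by (simp add: dist_norm)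
    then have "inverse (e k) * norm ((X k a - x a) - (X k b - x b)) \<le> C2 * \<bar>a - b\<bar>"
      using e(1)[of k] by (simp add: field_simps)
    then show ?thesis using e(1)[of k] by (simp add: q_def scaleR_diff_right[symmetric])
  qed
  have q_bound: "norm (q k s) \<le> C1" if "s \<in> {t..T}" for k s
  proof -
    have "inverse (e k) * norm (X k s - x s) \<le> C1"
      using bound[OF that, of k] e(1)[of k] by (simp add: field_simps)
    then show ?thesis using e(1)[of k] by (simp add: q_def)
  qed
  obtain v r where r: "strict_mono (r :: nat \<Rightarrow> nat)"
    and conv: "\<And>e. 0 < e \<Longrightarrow> \<exists>N. \<forall>n s. n \<ge> N \<and> s \<in> {t..T} \<longrightarrow> norm (q (r n) s - v s) < e"
  proof (rule Arzela_Ascoli[of "{t..T}" q C1])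
    show "\<exists>d>0. \<forall>n b. b \<in> {t..T} \<and> norm (a - b) < d \<longrightarrow> norm (q n a - q n b) < \<delta>"
      if a: "a \<in> {t..T}" and \<delta>: "\<delta> > 0" for a \<delta>
    proof (intro exI conjI allI impI)
      \<comment> \<open>The added \<open>1\<close> avoids division by zero when
        \<open>C2 = 0\<close>.\<close>
      show "\<delta> / (C2 + 1) > 0" using \<delta> C2 by simp
      fix n b assume b: "b \<in> {t..T} \<and> norm (a - b) < \<delta> / (C2 + 1)"
      then have "norm (q n a - q n b) \<le> C2 * \<bar>a - b\<bar>" using q_diff a by blast
      also have "\<dots> \<le> (C2 + 1) * \<bar>a - b\<bar>" by (intro mult_right_mono) auto
      also have "\<dots> < \<delta>" using b C2 by (simp add: field_simps)
      finally show "norm (q n a - q n b) < \<delta>" .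
    qed
  qed (use q_bound in auto)
  have ul: "uniform_limit {t..T} (\<lambda>j. q (r j)) v sequentially"
    unfolding uniform_limit_sequentially_iff dist_norm using conv by blast
  have qv: "(\<lambda>j. q (r j) s) \<longlonglongrightarrow> v s" if "s \<in> {t..T}" for s
    using ul that by (rule tendsto_uniform_limitI)
  define E where "E = (\<lambda>j. e (r j))"
  have E: "\<And>j. E j > 0" "E \<longlonglongrightarrow> 0"
    using e LIMSEQ_subseq_LIMSEQ[OF e(2) r] by (auto simp: E_def o_def)
  have v_lip: "C2-lipschitz_on {t..T} v"
  proof (rule lipschitz_onI[OF _ C2])
    fix a b assume ab: "a \<in> {t..T}" "b \<in> {t..T}"
    have "(\<lambda>j. norm (q (r j) a - q (r j) b)) \<longlonglongrightarrow> norm (v a - v b)"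
      by (intro tendsto_intros qv ab)
    then show "dist (v a) (v b) \<le> C2 * dist a b"
      unfolding dist_norm by (rule LIMSEQ_le_const2) (use q_diff[OF ab] in auto)
  qed
  have vt: "v t = vbar"
  proof (rule LIMSEQ_unique)
    show "(\<lambda>j. q (r j) t) \<longlonglongrightarrow> v t" using tT by (intro qv) simp
    have "q k t = \<omega> k 0 /\<^sub>R e k" for k using hist[of t k] h by (simp add: q_def)
    then show "(\<lambda>j. q (r j) t) \<longlonglongrightarrow> vbar"
      using LIMSEQ_subseq_LIMSEQ[OF init r] by (simp add: o_def)
  qed
  \<comment> \<open>A countable union of null sets, so that all quotients share one exceptional set;
    the end points are included because the derivatives are known in the open interval.\<close>
  define M where "M = (\<Union>k. N k) \<union> {t, T}"
  have M: "negligible M" using N by (auto simp: M_def intro!: negligible_countable_Union[where \<F>="range N", simplified])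
  have reg: "regular_time s" if "s \<in> {t..T} - M" for s using that der[of s 0] by (auto simp: M_def)
  \<comment> \<open>The value \<open>0\<close> on \<open>M\<close> makes domination by
    \<open>C2\<close> and convergence hold at every point, as the dominated convergence theorem
    demands.\<close>
  define g where "g = (\<lambda>j s. if s \<in> M then 0 else y' (r j) s /\<^sub>R E j)"
  define G where "G = (\<lambda>s. if s \<in> M then 0 else rhs v s)"
  have int: "(G has_integral v b - v a) {a..b}" if ab: "t \<le> a" "a \<le> b" "b \<le> T" for a b
  proof (rule has_integral_dominated_convergence[where f=g and h="\<lambda>_. C2"])
    show "(g j has_integral q (r j) b - q (r j) a) {a..b}" for j
    proof (rule fundamental_theorem_of_calculus_lipschitz[OF ab(2) _ M])
      show "C2-lipschitz_on {a..b} (q (r j))"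
        using ab by (intro lipschitz_onI C2) (auto simp: dist_norm q_diff)
      fix s assume s: "s \<in> {a..b} - M"
      then have s': "s \<in> {t<..<T} - N (r j)" using ab by (force simp: M_def)
      have "((\<lambda>s. inverse (E j) *\<^sub>R (X (r j) s - x s)) has_vector_derivative inverse (E j) *\<^sub>R y' (r j) s) (at s)"
        using der[OF s'] by (intro bounded_linear.has_vector_derivative[OF bounded_linear_scaleR_right]) auto
      then show "(q (r j) has_vector_derivative g j s) (at s within {a..b})"
        using s by (simp add: q_def g_def E_def has_vector_derivative_at_within)
    qed
    show "(\<lambda>_. C2) integrable_on {a..b}" by (rule integrable_const_ivl)
    show "\<forall>s\<in>{a..b}. norm (g j s) \<le> C2" for j
    proof
      fix s assume s: "s \<in> {a..b}"
      show "norm (g j s) \<le> C2"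
      proof (cases "s \<in> M")
        case False
        then have "s \<in> {t<..<T}" using s ab by (force simp: M_def)
        from y'_bound[OF this, of "r j"] show ?thesis
          using E(1)[of j] False by (simp add: g_def E_def field_simps)
      qed (use C2 in \<open>simp add: g_def\<close>)
    qed
    show "\<forall>s\<in>{a..b}. (\<lambda>j. g j s) \<longlonglongrightarrow> G s"
    proof
      fix s assume s: "s \<in> {a..b}"
      show "(\<lambda>j. g j s) \<longlonglongrightarrow> G s"
      proof (cases "s \<in> M")
        case False
        then have "regular_time s" using s ab by (intro reg) auto
        then have "(\<lambda>j. y' (r j) s /\<^sub>R E j) \<longlonglongrightarrow> rhs v s"
          unfolding y'_def
        proof (rule quotient_derivative_limit[where X="\<lambda>j. X (r j)" and e=E, OF _ E])
          show "(C2 * E j)-lipschitz_on {t..T} (\<lambda>s. X (r j) s - x s)" for j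
            using lip by (simp add: E_def)
          show "X (r j) s = x s" if "s \<in> {t - h..<t - E j}" for j s
            using hist[of s "r j"] supp[of "s - t" "r j"] that E(1)[of j] by (auto simp: E_def)
          show "(\<lambda>j. (X (r j) s - x s) /\<^sub>R E j) \<longlonglongrightarrow> v s" if "s \<in> {t..T}" for s
            using qv[OF that] by (simp add: q_def E_def)
        qed
        then show ?thesis using False by (simp add: g_def G_def)
      qed (simp add: g_def G_def)
    qed
    show "(\<lambda>j. q (r j) b - q (r j) a) \<longlonglongrightarrow> v b - v a"
      using ab by (intro tendsto_intros qv) auto
  qed
  \<comment> \<open>Lebesgue differentiation leads from the integral form back to the differential
    equation.\<close>
  obtain N' where N': "negligible N'" "\<And>s. s \<in> {t<..<T} - N' \<Longrightarrow> (v has_vector_derivative G s) (at s)"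
    using indefinite_integral_has_vector_derivative_ae_interval[of t T G v] int by blast
  have "AE s in lebesgue. s \<in> {t<..<T} \<longrightarrow> (v has_vector_derivative rhs v s) (at s)"
    unfolding eventually_ae_filter_negligible
  proof (intro exI conjI subsetI)
    show "negligible (M \<union> N')" using M N' by simp
    fix s assume s: "s \<in> {s. \<not> (s \<in> {t<..<T} \<longrightarrow> (v has_vector_derivative rhs v s) (at s))}"
    show "s \<in> M \<union> N'"
    proof (rule ccontr)
      assume "s \<notin> M \<union> N'"
      then show False using s N'(2)[of s] by (simp add: G_def)
    qed
  qed
  then have "is_linearized_solution T f\<^sub>z f\<^sub>y \<tau>\<^sub>z t \<alpha> x D vbar v"
    using v_lip vt by (auto simp: is_linearized_solution_rhs)
  then show thesis using that[OF r] ul by (simp add: q_def)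
qed

end

section \<open>Linearization of the state equation\<close>

text \<open>For a continuous function the essential supremum bounds every value: a larger value at
  \<open>\<theta>\<close> would persist on a nondegenerate interval, which would then be contained
  in a null set.\<close>

lemma norm_le_Linf_norm:
  assumes h: "h > 0" and w: "w \<in> Lip h" and fin: "Linf_norm h w < top" and \<theta>: "\<theta> \<in> {-h..0}"
  shows "norm (w \<theta>) \<le> enn2real (Linf_norm h w)"
proof (rule ccontr)
  let ?L = "enn2real (Linf_norm h w)"
  assume "\<not> norm (w \<theta>) \<le> ?L"
  then have gt: "?L < norm (w \<theta>)" by simp
  obtain C where C: "C-lipschitz_on {-h..0} w" using w by (auto simp: Lip_def)
  have "continuous_on {-h..0} (\<lambda>s. norm (w s))"
    by (intro continuous_intros lipschitz_on_continuous_on[OF C])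
  then have "((\<lambda>s. norm (w s)) \<longlongrightarrow> norm (w \<theta>)) (at \<theta> within {-h..0})"
    using \<theta> by (auto simp: continuous_on)
  then have "eventually (\<lambda>s. ?L < norm (w s)) (at \<theta> within {-h..0})"
    using gt by (rule order_tendstoD)
  then obtain r where r: "r > 0" "\<And>s. s \<in> {-h..0} \<Longrightarrow> s \<noteq> \<theta> \<Longrightarrow> dist s \<theta> < r \<Longrightarrow> ?L < norm (w s)"
    by (auto simp: eventually_at)
  have "AE s in lebesgue_on {-h..0}. ennreal (norm (w s)) \<le> Linf_norm h w"
    unfolding Linf_norm_def by (rule esssup_AE)
  then have "AE s in lebesgue. s \<in> {-h..0} \<longrightarrow> ennreal (norm (w s)) \<le> Linf_norm h w"
    by (simp add: AE_restrict_space_iff)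
  then obtain N where N: "negligible N" "\<And>s. s \<in> {-h..0} - N \<Longrightarrow> ennreal (norm (w s)) \<le> Linf_norm h w"
    by (auto simp: eventually_ae_filter_negligible)
  have le: "norm (w s) \<le> ?L" if "s \<in> {-h..0} - N" for s
    using N(2)[OF that] fin by (simp add: ennreal_le_iff[symmetric] del: ennreal_le_iff)
  \<comment> \<open>The neighbourhood of \<open>\<theta>\<close> is cut down to
    \<open>[-h, 0]\<close>; as \<open>h > 0\<close>, it stays nondegenerate even when
    \<open>\<theta>\<close> is an end point.\<close>
  define a where "a = max (-h) (\<theta> - r / 2)"
  define b where "b = min 0 (\<theta> + r / 2)"
  have ab: "a < b" using h r(1) \<theta> by (auto simp: a_def b_def)
  have "{a..b} \<subseteq> N"
  proof
    fix s assume s: "s \<in> {a..b}"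
    then have s': "s \<in> {-h..0}" "dist s \<theta> < r" using r(1) by (auto simp: a_def b_def dist_real_def)
    then have "?L < norm (w s)" using r(2)[of s] gt by (cases "s = \<theta>") auto
    then show "s \<in> N" using le[of s] s' by auto
  qed
  then have "negligible (cbox a b)" using N(1) by (auto intro: negligible_subset)
  then have "box a b = {}" by (simp only: negligible_interval)
  then show False using ab by (simp add: box_real)
qed

section \<open>Regularity and expansion of the delayed time\<close>

context delay_control_problem
begin

lemma delay_range: "s \<in> {t0..T} \<Longrightarrow> \<tau> s z \<in> {0..\<tau>bar}"
  using delay_nonneg cSUP_upper[OF _ delay_bounded, of "(s, z)"]
  by (simp add: delay_sup)

lemma delay_sup_nonneg: "\<tau>bar \<ge> 0"
  using delay_range[of T 0] horizon by simp

text \<open>Restricting to a slice of constant time stays within the strip on which the delay is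
  differentiable, so the state derivative is unrestricted even at the end points of
  \<open>[t0, T]\<close>.\<close>

lemma delay_derivative_state:
  assumes s: "s \<in> {t0..T}"
  shows "(\<tau> s has_derivative (\<lambda>k. \<tau>\<^sub>z s z \<bullet> k)) (at z)"
proof -
  have 1: "((\<lambda>z. (s, z)) has_derivative (\<lambda>k. (0, k))) (at z)"
    by (auto intro!: derivative_eq_intros)
  have 2: "((\<lambda>(t, z). \<tau> t z) has_derivative (\<lambda>(k, h). \<tau>\<^sub>t s z * k + \<tau>\<^sub>z s z \<bullet> h))
      (at (s, z) within range (\<lambda>z. (s, z)))"
    by (rule has_derivative_subset[OF delay_derivative[rule_format]]) (use s in auto)
  show ?thesis
    using has_derivative_in_compose[OF 1 2] by simp
qed

lemma delay_along_derivative: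
  assumes t: "t0 \<le> t" and s: "s \<in> {t<..<T}" and x: "(x has_vector_derivative x') (at s)"
  shows "((\<lambda>s. \<tau> s (x s)) has_vector_derivative \<tau>\<^sub>t s (x s) + \<tau>\<^sub>z s (x s) \<bullet> x') (at s)"
proof -
  have s': "at s within {t<..<T} = at s" using s by (intro at_within_open) auto
  have 1: "((\<lambda>s. (s, x s)) has_derivative (\<lambda>k. (k, k *\<^sub>R x'))) (at s within {t<..<T})"
    using x unfolding s' has_vector_derivative_def by (auto intro!: derivative_eq_intros)
  have 2: "((\<lambda>(t, z). \<tau> t z) has_derivative (\<lambda>(k, h). \<tau>\<^sub>t s (x s) * k + \<tau>\<^sub>z s (x s) \<bullet> h))
      (at (s, x s) within (\<lambda>s. (s, x s)) ` {t<..<T})"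
    by (rule has_derivative_subset[OF delay_derivative[rule_format]]) (use s t in auto)
  have "((\<lambda>s. \<tau> s (x s)) has_derivative (\<lambda>k. \<tau>\<^sub>t s (x s) * k + \<tau>\<^sub>z s (x s) \<bullet> (k *\<^sub>R x'))) (at s within {t<..<T})"
    using has_derivative_in_compose[OF 1 2] by simp
  then show ?thesis
    unfolding s' has_vector_derivative_def by (simp add: algebra_simps)
qed

text \<open>The state dependence is globally Lipschitz; the time dependence is controlled by the
  maximum of the continuous \<open>\<tau>\<^sub>t\<close> over a compact set containing the values
  of \<open>x\<close>.\<close>

lemma delay_along_lipschitz:
  assumes ab: "t0 \<le> a" and x: "C-lipschitz_on {a..T} x"
  obtains M where "M-lipschitz_on {a..T} (\<lambda>s. \<tau> s (x s))"
proof -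
  have C: "C \<ge> 0" using x by (rule lipschitz_on_nonneg)
  obtain l where l: "l > 0" "\<And>s z y. s \<in> {t0..T} \<Longrightarrow> \<bar>\<tau> s z - \<tau> s y\<bar> \<le> l * norm (z - y)"
    using delay_lipschitz by blast
  have "compact ({t0..T} \<times> x ` {a..T})"
    by (intro compact_Times compact_continuous_image lipschitz_on_continuous_on[OF x]) auto
  then have "compact ((\<lambda>(t, z). \<tau>\<^sub>t t z) ` ({t0..T} \<times> x ` {a..T}))"
    by (rule compact_continuous_image[rotated]) (rule continuous_on_subset[OF delay_C1(1)], auto)
  then have "bounded ((\<lambda>(t, z). \<tau>\<^sub>t t z) ` ({t0..T} \<times> x ` {a..T}))"
    by (rule compact_imp_bounded)
  then obtain B where B: "B > 0" "\<And>s r. s \<in> {t0..T} \<Longrightarrow> r \<in> {a..T} \<Longrightarrow> \<bar>\<tau>\<^sub>t s (x r)\<bar> \<le> B"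
    unfolding bounded_pos by fastforce
  \<comment> \<open>The state is frozen at \<open>x r\<close> while time moves, which is why the
    compact set above is a product and not the graph of \<open>x\<close>.\<close>
  have time: "\<bar>\<tau> s (x r) - \<tau> s' (x r)\<bar> \<le> B * \<bar>s - s'\<bar>"
    if "s \<in> {t0..T}" "s' \<in> {t0..T}" "r \<in> {a..T}" for s s' r
  proof -
    have "norm (\<tau> s (x r) - \<tau> s' (x r)) \<le> B * norm (s - s')"
    proof (rule differentiable_bound[of "{t0..T}" "\<lambda>s. \<tau> s (x r)" "\<lambda>s k. \<tau>\<^sub>t s (x r) * k"])
      fix q assume q: "q \<in> {t0..T}"
      have 1: "((\<lambda>s. (s, x r)) has_derivative (\<lambda>k. (k, 0))) (at q within {t0..T})"
        by (auto intro!: derivative_eq_intros)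
      have 2: "((\<lambda>(t, z). \<tau> t z) has_derivative (\<lambda>(k, h). \<tau>\<^sub>t q (x r) * k + \<tau>\<^sub>z q (x r) \<bullet> h))
          (at (q, x r) within (\<lambda>s. (s, x r)) ` {t0..T})"
        by (rule has_derivative_subset[OF delay_derivative[rule_format, OF q]]) auto
      show "((\<lambda>s. \<tau> s (x r)) has_derivative (\<lambda>k. \<tau>\<^sub>t q (x r) * k)) (at q within {t0..T})"
        using has_derivative_in_compose[OF 1 2] by simp
      show "onorm ((*) (\<tau>\<^sub>t q (x r))) \<le> B"
        using B(2)[OF q that(3)] by (intro onorm_le) (auto simp: abs_mult mult_right_mono)
    qed (use that in auto)
    then show ?thesis by simp
  qed
  have "(l * C + B)-lipschitz_on {a..T} (\<lambda>s. \<tau> s (x s))"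
  proof (rule lipschitz_onI)
    fix s s' assume s: "s \<in> {a..T}" "s' \<in> {a..T}"
    have "\<bar>\<tau> s (x s) - \<tau> s (x s')\<bar> \<le> l * (C * \<bar>s - s'\<bar>)"
    proof -
      have "\<bar>\<tau> s (x s) - \<tau> s (x s')\<bar> \<le> l * norm (x s - x s')" using s ab by (intro l) auto
      also have "\<dots> \<le> l * (C * \<bar>s - s'\<bar>)"
        using lipschitz_onD[OF x s] l(1) by (intro mult_left_mono) (auto simp: dist_norm)
      finally show ?thesis .
    qed
    moreover have "\<bar>\<tau> s (x s') - \<tau> s' (x s')\<bar> \<le> B * \<bar>s - s'\<bar>"
      using s ab by (intro time) auto
    ultimately show "dist (\<tau> s (x s)) (\<tau> s' (x s')) \<le> (l * C + B) * dist s s'"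
      by (simp add: dist_real_def algebra_simps)
  qed (use l B C in auto)
  then show thesis by (rule that)
qed

text \<open>The derivative of the delayed time is the expression bounded below in the monotone delay
  condition. Integrating that bound gives quantitative strict monotonicity.\<close>

lemma delayed_time_expands:
  assumes t: "t \<in> {t0..T}" and w: "w \<in> P_set \<tau>bar r" "r > 0" and \<alpha>: "\<alpha> \<in> controls A t T"
    and x: "is_trajectory \<tau>bar T f \<tau> t w \<alpha> x"
  obtains d where "d > 0" "\<And>s s'. t \<le> s \<Longrightarrow> s \<le> s' \<Longrightarrow> s' \<le> T \<Longrightarrow>
     d * (s' - s) \<le> (s' - \<tau> s' (x s')) - (s - \<tau> s (x s))"
proof -
  obtain d where d: "d > 0" "AE s in lebesgue. s \<in> {t..T} \<longrightarrow>
      1 - \<tau>\<^sub>t s (x s) - \<tau>\<^sub>z s (x s) \<bullet> vector_derivative x (at s) \<ge> d"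
    using delay_monotone w \<alpha> x t by blast
  have "AE s in lebesgue. s \<in> {t<..<T} \<longrightarrow> (x has_vector_derivative f s (x s) (x (s - \<tau> s (x s))) (\<alpha> s)) (at s)"
    using x by (simp add: is_trajectory_def)
  \<comment> \<open>The bound on \<open>vector_derivative\<close> says something about
    \<open>x\<close> only where \<open>x\<close> is differentiable, so it is combined with the state
    equation.\<close>
  with d(2) have "AE s in lebesgue. s \<in> {t<..<T} \<longrightarrow> x differentiable (at s) \<and>
      1 - \<tau>\<^sub>t s (x s) - \<tau>\<^sub>z s (x s) \<bullet> vector_derivative x (at s) \<ge> d"
    by eventually_elim (auto intro: differentiableI_vector)
  then obtain N where N: "negligible N" "\<And>s. s \<in> {t<..<T} - N \<Longrightarrow> x differentiable (at s) \<and>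
      1 - \<tau>\<^sub>t s (x s) - \<tau>\<^sub>z s (x s) \<bullet> vector_derivative x (at s) \<ge> d"
    by (auto simp: eventually_ae_filter_negligible)
  obtain C where C: "C-lipschitz_on {t - \<tau>bar..T} x" using x by (auto simp: is_trajectory_def)
  have "C-lipschitz_on {t..T} x"
    using delay_sup_nonneg by (intro lipschitz_on_subset[OF C]) auto
  then obtain M where M: "M-lipschitz_on {t..T} (\<lambda>s. \<tau> s (x s))"
    using delay_along_lipschitz t by (metis atLeastAtMost_iff)
  show thesis
  proof (rule that[OF d(1)])
    fix s s' assume s: "t \<le> s" "s \<le> s'" "s' \<le> T"
    show "d * (s' - s) \<le> (s' - \<tau> s' (x s')) - (s - \<tau> s (x s))"
    proof (rule lipschitz_on_increment_ge[OF s(2) _ N(1)])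
      show "(1 + M)-lipschitz_on {s..s'} (\<lambda>s. s - \<tau> s (x s))"
        using s by (intro lipschitz_on_diff lipschitz_on_subset[OF M]) (auto intro: lipschitz_intros)
      fix q assume q: "q \<in> {s<..<s'} - N"
      then have q': "q \<in> {t<..<T} - N" using s by auto
      have "(x has_vector_derivative vector_derivative x (at q)) (at q)"
        using N(2)[OF q'] by (simp add: vector_derivative_works)
      then have "((\<lambda>s. s - \<tau> s (x s)) has_vector_derivative
          1 - (\<tau>\<^sub>t q (x q) + \<tau>\<^sub>z q (x q) \<bullet> vector_derivative x (at q))) (at q)"
        using q' t by (intro has_vector_derivative_diff has_vector_derivative_id delay_along_derivative) auto
      moreover have "1 - (\<tau>\<^sub>t q (x q) + \<tau>\<^sub>z q (x q) \<bullet> vector_derivative x (at q)) \<ge> d"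
        using N(2)[OF q'] by simp
      ultimately show "\<exists>p'. ((\<lambda>s. s - \<tau> s (x s)) has_vector_derivative p') (at q) \<and> d \<le> p'" by blast
    qed
  qed
qed

end

section \<open>Size of the perturbations and the linearization theorem\<close>

text \<open>For \<open>h > 0\<close> the order of the essential supremum passes to every value. For
  \<open>h = 0\<close> the interval is a single point, a null set on which the essential supremum
  carries no information, and the expansion of \<open>w\<epsilon> \<epsilon> 0\<close> supplies the
  bound.\<close>

lemma perturbation_linear_bound:
  fixes w\<epsilon> :: "real \<Rightarrow> real \<Rightarrow> real ^ 'n"
  assumes h: "h \<ge> 0"
    and w\<epsilon>: "\<And>\<epsilon>. \<epsilon> > 0 \<Longrightarrow> w\<epsilon> \<epsilon> \<in> V_set h R"
    and bigo: "(\<lambda>\<epsilon>. enn2real (Linf_norm h (w\<epsilon> \<epsilon>))) \<in> O[at_right 0](\<lambda>\<epsilon>. \<epsilon>)"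
    and init: "(\<lambda>\<epsilon>. norm (w\<epsilon> \<epsilon> 0 - \<epsilon> *\<^sub>R vbar)) \<in> o[at_right 0](\<lambda>\<epsilon>. \<epsilon>)"
  obtains C \<delta> where "C \<ge> 0" "\<delta> > 0"
    "\<And>\<epsilon> \<theta>. 0 < \<epsilon> \<Longrightarrow> \<epsilon> < \<delta> \<Longrightarrow> \<theta> \<in> {-h..0} \<Longrightarrow> norm (w\<epsilon> \<epsilon> \<theta>) \<le> C * \<epsilon>"
proof (cases "h = 0")
  case True
  have "eventually (\<lambda>\<epsilon>. norm (norm (w\<epsilon> \<epsilon> 0 - \<epsilon> *\<^sub>R vbar)) \<le> 1 * norm \<epsilon>) (at_right 0)"
    using init by (rule landau_o.smallD) simp
  then obtain \<delta> where \<delta>: "\<delta> > 0" "\<And>\<epsilon>. 0 < \<epsilon> \<Longrightarrow> \<epsilon> < \<delta> \<Longrightarrow> norm (w\<epsilon> \<epsilon> 0 - \<epsilon> *\<^sub>R vbar) \<le> \<epsilon>"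
    by (auto simp: eventually_at_right_field)
  show thesis
  proof (rule that[OF _ \<delta>(1)])
    show "0 \<le> norm vbar + 1" by simp
    fix \<epsilon> \<theta> assume \<epsilon>: "0 < \<epsilon>" "\<epsilon> < \<delta>" "\<theta> \<in> {-h..0}"
    have "norm (w\<epsilon> \<epsilon> 0) \<le> norm (w\<epsilon> \<epsilon> 0 - \<epsilon> *\<^sub>R vbar) + norm (\<epsilon> *\<^sub>R vbar)"
      using norm_triangle_ineq[of "w\<epsilon> \<epsilon> 0 - \<epsilon> *\<^sub>R vbar" "\<epsilon> *\<^sub>R vbar"] by simp
    also have "\<dots> \<le> \<epsilon> + \<epsilon> * norm vbar" using \<delta>(2)[OF \<epsilon>(1,2)] \<epsilon>(1) by simp
    finally show "norm (w\<epsilon> \<epsilon> \<theta>) \<le> (norm vbar + 1) * \<epsilon>" using \<epsilon>(3) True by (simp add: algebra_simps)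
  qed
next
  case False
  then have h: "h > 0" using h by simp
  obtain C where C: "C > 0" "eventually (\<lambda>\<epsilon>. norm (enn2real (Linf_norm h (w\<epsilon> \<epsilon>))) \<le> C * norm \<epsilon>) (at_right 0)"
    using bigo by (rule landau_o.bigE)
  then obtain \<delta> where \<delta>: "\<delta> > 0" "\<And>\<epsilon>. 0 < \<epsilon> \<Longrightarrow> \<epsilon> < \<delta> \<Longrightarrow> enn2real (Linf_norm h (w\<epsilon> \<epsilon>)) \<le> C * \<epsilon>"
    by (auto simp: eventually_at_right_field)
  show thesis
  proof (rule that[OF _ \<delta>(1)])
    show "0 \<le> C" using C by simp
    fix \<epsilon> \<theta> assume \<epsilon>: "0 < \<epsilon>" "\<epsilon> < \<delta>" "\<theta> \<in> {-h..0}"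
    \<comment> \<open>The bound by \<open>R\<close> makes the norm finite; \<open>enn2real\<close>
      would turn an infinite norm into \<open>0\<close>.\<close>
    have "w\<epsilon> \<epsilon> \<in> Lip h" "Linf_norm h (w\<epsilon> \<epsilon>) \<le> ennreal R"
      using w\<epsilon>[OF \<epsilon>(1)] by (auto simp: V_set_def P_set_def)
    then have "norm (w\<epsilon> \<epsilon> \<theta>) \<le> enn2real (Linf_norm h (w\<epsilon> \<epsilon>))"
      using h \<epsilon>(3) by (intro norm_le_Linf_norm) (auto intro: le_less_trans)
    then show "norm (w\<epsilon> \<epsilon> \<theta>) \<le> C * \<epsilon>" using \<delta>(2)[OF \<epsilon>(1,2)] by simp
  qed
qed

text \<open>The uniform \<open>o(\<epsilon>)\<close> is expressed by uniform convergence to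
  \<open>0\<close> of the remainder divided by \<open>\<epsilon>\<close>. Uniqueness is claimed on
  \<open>[t, T]\<close> because solutions are represented by total functions. The proof is a
  subsequence argument.\<close>

theorem lemma5p1:
  fixes t0 T t \<tau>bar R :: real
    and A :: "(real ^ 'm) set"
    and f :: "real \<Rightarrow> real ^ 'n \<Rightarrow> real ^ 'n \<Rightarrow> real ^ 'm \<Rightarrow> real ^ 'n"
    and L :: "real \<Rightarrow> real ^ 'n \<Rightarrow> real ^ 'n \<Rightarrow> real ^ 'm \<Rightarrow> real"
    and g :: "(real ^ 'n) \<times> (real \<Rightarrow> real ^ 'n) \<Rightarrow> real"
    and \<tau> \<tau>\<^sub>t :: "real \<Rightarrow> real ^ 'n \<Rightarrow> real"
    and \<tau>\<^sub>z :: "real \<Rightarrow> real ^ 'n \<Rightarrow> real ^ 'n"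
    and f\<^sub>z f\<^sub>y :: "real \<Rightarrow> real ^ 'n \<Rightarrow> real ^ 'n \<Rightarrow> real ^ 'm \<Rightarrow> real ^ 'n ^ 'n"
    and w x :: "real \<Rightarrow> real ^ 'n"
    and \<alpha> :: "real \<Rightarrow> real ^ 'm"
    and D :: "real \<Rightarrow> real"
    and w\<epsilon> x\<epsilon> :: "real \<Rightarrow> real \<Rightarrow> real ^ 'n"
    and vbar :: "real ^ 'n"
  assumes problem: "delay_control_problem t0 T A f L g \<tau> \<tau>bar f\<^sub>z f\<^sub>y \<tau>\<^sub>t \<tau>\<^sub>z"
    and t: "t \<in> {t0..T}"
    and \<alpha>: "\<alpha> \<in> controls A t T"
    and x: "is_trajectory \<tau>bar T f \<tau> t w \<alpha> x"
    and D: "\<And>s. D s = s - \<tau> s (x s)"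
    and R: "R > 0"
    and w: "w \<in> V_set \<tau>bar R"
    and w\<epsilon>: "\<And>\<epsilon>. \<epsilon> > 0 \<Longrightarrow> w\<epsilon> \<epsilon> \<in> V_set \<tau>bar R"
    and w\<epsilon>_support: "\<And>\<epsilon>. \<epsilon> > 0 \<Longrightarrow> closure (support_on {-\<tau>bar..0} (w\<epsilon> \<epsilon>)) \<subseteq> {-\<epsilon>..0}"
    and w\<epsilon>_bigo: "(\<lambda>\<epsilon>. enn2real (Linf_norm \<tau>bar (w\<epsilon> \<epsilon>))) \<in> O[at_right 0](\<lambda>\<epsilon>. \<epsilon>)"
    and w\<epsilon>_0: "(\<lambda>\<epsilon>. norm (w\<epsilon> \<epsilon> 0 - \<epsilon> *\<^sub>R vbar)) \<in> o[at_right 0](\<lambda>\<epsilon>. \<epsilon>)"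
    and x\<epsilon>: "\<And>\<epsilon>. \<epsilon> > 0 \<Longrightarrow> is_trajectory \<tau>bar T f \<tau> t (\<lambda>\<theta>. w \<theta> + w\<epsilon> \<epsilon> \<theta>) \<alpha> (x\<epsilon> \<epsilon>)"
  shows "\<exists>v. is_linearized_solution T f\<^sub>z f\<^sub>y \<tau>\<^sub>z t \<alpha> x D vbar v \<and>
      (\<forall>v'. is_linearized_solution T f\<^sub>z f\<^sub>y \<tau>\<^sub>z t \<alpha> x D vbar v' \<longrightarrow> (\<forall>s\<in>{t..T}. v' s = v s)) \<and>
      uniform_limit {t..T} (\<lambda>\<epsilon> s. (x\<epsilon> \<epsilon> s - x s - \<epsilon> *\<^sub>R v s) /\<^sub>R \<epsilon>) (\<lambda>s. 0) (at_right 0)"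
proof -
  interpret P: delay_control_problem t0 T A f L g \<tau> \<tau>bar f\<^sub>z f\<^sub>y \<tau>\<^sub>t \<tau>\<^sub>z by (rule problem)
  let ?sol = "is_linearized_solution T f\<^sub>z f\<^sub>y \<tau>\<^sub>z t \<alpha> x D vbar"
  have sub: "s \<in> {t0..T}" if "s \<in> {t..T}" for s using that t by auto
  obtain Kf where Kf: "Kf > 0" "\<And>s a z y z' y'. s \<in> {t0..T} \<Longrightarrow> a \<in> A \<Longrightarrow>
      norm (f s z y a - f s z' y' a) \<le> Kf * (norm (z - z') + norm (y - y'))"
    using P.f_lipschitz by blast
  obtain K\<tau> where K\<tau>: "K\<tau> > 0" "\<And>s z y. s \<in> {t0..T} \<Longrightarrow> \<bar>\<tau> s z - \<tau> s y\<bar> \<le> K\<tau> * norm (z - y)"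
    using P.delay_lipschitz by blast
  obtain Cx where Cx: "Cx-lipschitz_on {t - \<tau>bar..T} x" using x by (auto simp: is_trajectory_def)
  have "w \<in> P_set \<tau>bar R" using w by (simp add: V_set_def)
  then obtain d where d: "d > 0" "\<And>s s'. t \<le> s \<Longrightarrow> s \<le> s' \<Longrightarrow> s' \<le> T \<Longrightarrow>
     d * (s' - s) \<le> (s' - \<tau> s' (x s')) - (s - \<tau> s (x s))"
    using P.delayed_time_expands[OF t _ R \<alpha> x] by blast
  interpret Q: delay_trajectory t T \<tau>bar A f f\<^sub>z f\<^sub>y \<tau> \<tau>\<^sub>z \<alpha> w x D Kf K\<tau> Cx d
  proof
    show "Cx \<ge> 0" using Cx by (rule lipschitz_on_nonneg)
    show "\<alpha> s \<in> A" if "s \<in> {t<..<T}" for s using \<alpha> that by (auto simp: controls_def)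
    show "((\<lambda>(z, y). f s z y a) has_derivative (\<lambda>(h, k). f\<^sub>z s z y a *v h + f\<^sub>y s z y a *v k)) (at (z, y))"
      if "s \<in> {t..T}" "a \<in> A" for s a z y
      using P.f_derivative sub that by blast
  qed (use t Kf K\<tau> Cx d x D sub P.delay_range P.delay_derivative_state in auto)
  obtain C \<delta> where C: "C \<ge> 0" "\<delta> > 0"
    "\<And>\<epsilon> \<theta>. 0 < \<epsilon> \<Longrightarrow> \<epsilon> < \<delta> \<Longrightarrow> \<theta> \<in> {-\<tau>bar..0} \<Longrightarrow> norm (w\<epsilon> \<epsilon> \<theta>) \<le> C * \<epsilon>"
    using perturbation_linear_bound[OF P.delay_sup_nonneg w\<epsilon> w\<epsilon>_bigo w\<epsilon>_0] by blast
  have init: "((\<lambda>\<epsilon>. norm (w\<epsilon> \<epsilon> 0 - \<epsilon> *\<^sub>R vbar) / \<epsilon>) \<longlongrightarrow> 0) (at_right 0)"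
    using w\<epsilon>_0 by (rule smalloD_tendsto)
  \<comment> \<open>The steps must stay below \<open>\<delta>\<close>, where the linear bound on the
    perturbations is valid.\<close>
  have key: "\<exists>r v. strict_mono r \<and> ?sol v \<and>
      uniform_limit {t..T} (\<lambda>j s. (x\<epsilon> (e (r j)) s - x s) /\<^sub>R e (r j)) v sequentially"
    if e: "\<And>k. 0 < e k" "\<And>k. e k < \<delta>" "e \<longlonglongrightarrow> 0" for e :: "nat \<Rightarrow> real"
  proof -
    have supp: "w\<epsilon> (e k) \<theta> = 0" if "\<theta> \<in> {-\<tau>bar..0}" "\<theta> < - e k" for k \<theta>
    proof (rule ccontr)
      assume "w\<epsilon> (e k) \<theta> \<noteq> 0"
      then have "\<theta> \<in> closure (support_on {-\<tau>bar..0} (w\<epsilon> (e k)))"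
        using that(1) by (intro subsetD[OF closure_subset]) (simp add: support_on_def)
      then show False using w\<epsilon>_support[OF e(1)[of k]] that(2) by auto
    qed
    have "filterlim e (at_right 0) sequentially"
      using e(1,3) by (intro tendsto_imp_filterlim_at_right) auto
    then have "(\<lambda>k. norm (w\<epsilon> (e k) 0 - e k *\<^sub>R vbar) / e k) \<longlonglongrightarrow> 0"
      using filterlim_compose[OF init] by blast
    moreover have "norm (w\<epsilon> (e k) 0 - e k *\<^sub>R vbar) / e k = norm (w\<epsilon> (e k) 0 /\<^sub>R e k - vbar)" for k
    proof -
      have "w\<epsilon> (e k) 0 /\<^sub>R e k - vbar = (w\<epsilon> (e k) 0 - e k *\<^sub>R vbar) /\<^sub>R e k"
        using e(1)[of k] by (simp add: scaleR_diff_right)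
      then show ?thesis using e(1)[of k] by (simp add: divide_inverse_commute)
    qed
    ultimately have "(\<lambda>k. w\<epsilon> (e k) 0 /\<^sub>R e k - vbar) \<longlonglongrightarrow> 0"
      by (simp add: tendsto_norm_zero_iff)
    then have lim: "(\<lambda>k. w\<epsilon> (e k) 0 /\<^sub>R e k) \<longlonglongrightarrow> vbar" by (simp add: LIM_zero_iff)
    obtain r v where "strict_mono r" "?sol v"
      "uniform_limit {t..T} (\<lambda>j s. (x\<epsilon> (e (r j)) s - x s) /\<^sub>R e (r j)) v sequentially"
      by (rule Q.quotients_converge_along_subsequence[where X="\<lambda>k. x\<epsilon> (e k)" and \<omega>="\<lambda>k. w\<epsilon> (e k)" and C=C,
            OF x\<epsilon>[OF e(1)] C(3)[OF e(1) e(2)] supp lim e(1) e(3) C(1) P.delay_sup_nonneg])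
    then show ?thesis by (intro exI conjI)
  qed
  \<comment> \<open>Any admissible sequence will do here; it serves to produce one solution
    \<open>v\<close>.\<close>
  have "(\<lambda>k. \<delta> / 2 * inverse (real (Suc k))) \<longlonglongrightarrow> \<delta> / 2 * 0"
    by (intro tendsto_intros LIMSEQ_inverse_real_of_nat)
  moreover have "\<delta> / 2 * inverse (real (Suc k)) < \<delta>" for k
  proof -
    have "\<delta> / 2 * inverse (real (Suc k)) \<le> \<delta> / 2 * 1" using C(2) by (intro mult_left_mono) (auto simp: field_simps)
    then show ?thesis using C(2) by simp
  qed
  ultimately obtain v where v: "?sol v"
    using key[of "\<lambda>k. \<delta> / 2 * inverse (real (Suc k))"] C(2) by auto
  have unique: "v' s = v s" if "?sol v'" "s \<in> {t..T}" for v' s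
    using Q.linearized_solution_unique[OF that(1) v that(2)] .
  have "uniform_limit {t..T} (\<lambda>\<epsilon> s. (x\<epsilon> \<epsilon> s - x s - \<epsilon> *\<^sub>R v s) /\<^sub>R \<epsilon>) (\<lambda>s. 0) (at_right 0)"
  \<comment> \<open>A failure of uniform convergence yields a sequence of steps whose remainders all
    exceed some \<open>\<eta>\<close>. By \<open>key\<close> a subsequence of quotients converges
    uniformly to a solution, which by uniqueness is \<open>v\<close>, a contradiction.\<close>
  proof (rule ccontr)
    assume "\<not> ?thesis"
    then obtain \<eta> where \<eta>: "\<eta> > 0" and ev:
      "\<not> eventually (\<lambda>\<epsilon>. \<forall>s\<in>{t..T}. dist ((x\<epsilon> \<epsilon> s - x s - \<epsilon> *\<^sub>R v s) /\<^sub>R \<epsilon>) 0 < \<eta>) (at_right 0)"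
      unfolding uniform_limit_iff by blast
    have "\<forall>k. \<exists>\<epsilon>>0. \<epsilon> < min \<delta> (inverse (real (Suc k))) \<and>
        \<not> (\<forall>s\<in>{t..T}. dist ((x\<epsilon> \<epsilon> s - x s - \<epsilon> *\<^sub>R v s) /\<^sub>R \<epsilon>) 0 < \<eta>)"
    proof
      fix k
      have "min \<delta> (inverse (real (Suc k))) > 0" using C(2) by simp
      then show "\<exists>\<epsilon>>0. \<epsilon> < min \<delta> (inverse (real (Suc k))) \<and>
        \<not> (\<forall>s\<in>{t..T}. dist ((x\<epsilon> \<epsilon> s - x s - \<epsilon> *\<^sub>R v s) /\<^sub>R \<epsilon>) 0 < \<eta>)"
        using ev unfolding eventually_at_right_field by blast
    qed
    then obtain e where e: "\<And>k. 0 < e k" "\<And>k. e k < min \<delta> (inverse (real (Suc k)))"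
        "\<And>k. \<not> (\<forall>s\<in>{t..T}. dist ((x\<epsilon> (e k) s - x s - e k *\<^sub>R v s) /\<^sub>R e k) 0 < \<eta>)"
      by metis
    have "e \<longlonglongrightarrow> 0"
      by (rule tendsto_sandwich[OF _ _ tendsto_const LIMSEQ_inverse_real_of_nat])
         (use e in \<open>auto intro!: always_eventually less_imp_le\<close>)
    then obtain r v' where r: "?sol v'"
        "uniform_limit {t..T} (\<lambda>j s. (x\<epsilon> (e (r j)) s - x s) /\<^sub>R e (r j)) v' sequentially"
      using key[of e] e by auto
    obtain j where j: "\<And>s. s \<in> {t..T} \<Longrightarrow> norm ((x\<epsilon> (e (r j)) s - x s) /\<^sub>R e (r j) - v' s) < \<eta>"
      using r(2) \<eta> unfolding uniform_limit_sequentially_iff dist_norm by blast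
    have "dist ((x\<epsilon> (e (r j)) s - x s - e (r j) *\<^sub>R v s) /\<^sub>R e (r j)) 0 < \<eta>" if s: "s \<in> {t..T}" for s
    proof -
      have "(x\<epsilon> (e (r j)) s - x s - e (r j) *\<^sub>R v s) /\<^sub>R e (r j) = (x\<epsilon> (e (r j)) s - x s) /\<^sub>R e (r j) - v' s"
        using e(1)[of "r j"] unique[OF r(1) s] by (simp add: scaleR_diff_right)
      then show ?thesis using j[OF s] by (simp add: dist_norm)
    qed
    then show False using e(3)[of "r j"] by blast
  qed
  then show ?thesis using v unique by blast
qed

end
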